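(* Let $(M,F,dV)$ be an AR-Finsler manifold, with $g_{ij}=\eta\,a_{ij}$, equipped with an arbitrary volume form $dV$, such that $F(x,y)$ is not rational in $y$ and the functions $\partial_i\log(\eta(x,y))$ are rational in $y$ for all $i$. If $(M,F,dV)$ has isotropic $S$-curvature, then its $S$-curvature vanishes identically.
   Context: $M$ is a smooth $n$-dimensional manifold with local coordinates $(x^i)$ and induced fibre coordinates $(y^i)$ on $TM$; $\partial_i=\partial/\partial x^i$, $\dot{\partial}_i=\partial/\partial y^i$; the summation convention is used. A Finsler metric on $M$ is a map $F:TM\to[0,\infty)$ which is $C^\infty$ on $TM\setminus\{0\}$, positively homogeneous of degree one in $y$, and such that $g_{ij}(x,y):=\frac12\dot{\partial}_i\dot{\partial}_jF^2$ is positive definite at each point of $TM\setminus\{0\}$; $(g^{ij})$ is the inverse matrix. "Rational in $y$" means: locally in $x$, a quotient of two polynomials in $y$ whose coefficients are smooth functions of $x$; "$F$ is not rational in $y$" means that for no point $x\in M$ is $F(x,\cdot)$ a rational function of $y$. $F$ is an AR-Finsler metric (and $(M,F)$ an AR-Finsler manifold) if $g_{ij}(x,y)=\eta(x,y)\,a_{ij}(x,y)$ where (a) $\eta:TM\setminus\{0\}\to[0,\infty)$ is smooth; (b) $(a_{ij}(x,y))$ is a symmetric positive definite matrix with each $a_{ij}$ rational in $y$; (c) each product $\eta\,a_{ij}$ is positively homogeneous of degree zero in $y$. Such a decomposition is fixed. Spray coefficients: $G^i=\frac14 g^{ir}\left(y^k\dot{\partial}_r\partial_kF^2-\partial_rF^2\right)$;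 Barthel connection: $N^i_j=\dot{\partial}_jG^i$. For a volume form $dV=\sigma(x)\,dx^1\wedge\dots\wedge dx^n$, $\sigma>0$, the $S$-curvature is $S(x,y)=N^m_m(x,y)-y^m\partial_m\log(\sigma(x))$. The $S$-curvature is isotropic if there is a function $A$ on $M$ with $S(x,y)=(n+1)\,A(x)\,F(x,y)$. *)

theory Defs
  imports "HOL-Analysis.Analysis"
begin

text \<open>For open \<open>S\<close>, \<open>smooth_on S f\<close> says that \<open>f\<close> is \<open>C\<^sup>\<infinity>\<close> on \<open>S\<close>: all iterated
  directional derivatives exist and are (totally) differentiable.\<close>

primrec diff_times_on ::
  "nat \<Rightarrow> 'a::real_normed_vector set \<Rightarrow> ('a \<Rightarrow> 'b::real_normed_vector) \<Rightarrow> bool" where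
  "diff_times_on 0 S f \<longleftrightarrow> continuous_on S f"
| "diff_times_on (Suc k) S f \<longleftrightarrow>
     (\<forall>x\<in>S. f differentiable (at x)) \<and>
     (\<forall>v. diff_times_on k S (\<lambda>x. frechet_derivative f (at x) v))"

definition smooth_on ::
  "'a::real_normed_vector set \<Rightarrow> ('a \<Rightarrow> 'b::real_normed_vector) \<Rightarrow> bool" where
  "smooth_on S f \<longleftrightarrow> (\<forall>k. diff_times_on k S f)"

text \<open>A chart is a pair (domain, coordinate map); the values of the coordinate map outside the
  domain are irrelevant.\<close>

type_synonym ('m, 'n) chart = "'m set \<times> ('m \<Rightarrow> real^'n)"

definition chart_range :: "('m, 'n) chart \<Rightarrow> (real^'n) set" where
  "chart_range c = snd c ` fst c"

definition chart_inv :: "('m, 'n) chart \<Rightarrow> real^'n \<Rightarrow> 'm" where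
  "chart_inv c = inv_into (fst c) (snd c)"

definition transition :: "('m, 'n) chart \<Rightarrow> ('m, 'n) chart \<Rightarrow> real^'n \<Rightarrow> real^'n" where
  "transition c d = snd d \<circ> chart_inv c"

text \<open>The atlas is not required to be maximal.\<close>

definition smooth_atlas ::
  "('m::{t2_space, second_countable_topology}, 'n::finite) chart set \<Rightarrow> bool" where
  "smooth_atlas \<A> \<longleftrightarrow>
     (\<Union>c\<in>\<A>. fst c) = UNIV \<and>
     (\<forall>c\<in>\<A>. open (fst c) \<and> open (chart_range c) \<and>
        homeomorphism (fst c) (chart_range c) (snd c) (chart_inv c)) \<and>
     (\<forall>c\<in>\<A>. \<forall>d\<in>\<A>. smooth_on (snd c ` (fst c \<inter> fst d)) (transition c d))"

text \<open>A tangent vector is a base point together with the family of its components in all charts of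
  the atlas around that point, the components in two charts being related by the Jacobian of the
  transition map (and set to 0 for charts not containing the point).
  \<open>tangent \<A> c x y\<close> is the vector \<open>y\<^sup>i \<partial>/\<partial>x\<^sup>i\<close> at the point with coordinates \<open>x\<close> in the
  chart \<open>c\<close>; by the chain rule, pairs \<open>(x, y)\<close> in different charts that are related by a change of
  the induced coordinates give the same element.\<close>

type_synonym ('m, 'n) tvec = "'m \<times> (('m, 'n) chart \<Rightarrow> real^'n)"

definition tangent ::
  "('m, 'n::finite) chart set \<Rightarrow> ('m, 'n) chart \<Rightarrow> real^'n \<Rightarrow> real^'n \<Rightarrow> ('m, 'n) tvec" where
  "tangent \<A> c x y =
     (chart_inv c x,
      \<lambda>d. if d \<in> \<A> \<and> chart_inv c x \<in> fst d
          then frechet_derivative (transition c d) (at x) y else 0)"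

definition in_coords ::
  "('m, 'n::finite) chart set \<Rightarrow> (('m, 'n) tvec \<Rightarrow> real) \<Rightarrow> ('m, 'n) chart \<Rightarrow>
     real^'n \<Rightarrow> real^'n \<Rightarrow> real" where
  "in_coords \<A> f c x y = f (tangent \<A> c x y)"

definition d_x :: "'n::finite \<Rightarrow> (real^'n \<Rightarrow> real^'n \<Rightarrow> real) \<Rightarrow> real^'n \<Rightarrow> real^'n \<Rightarrow> real" where
  "d_x i f x y = deriv (\<lambda>t. f (x + t *\<^sub>R axis i 1) y) 0"

definition d_y :: "'n::finite \<Rightarrow> (real^'n \<Rightarrow> real^'n \<Rightarrow> real) \<Rightarrow> real^'n \<Rightarrow> real^'n \<Rightarrow> real" where
  "d_y i f x y = deriv (\<lambda>t. f x (y + t *\<^sub>R axis i 1)) 0"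

definition pos_def_sym :: "real^'n^'n \<Rightarrow> bool" where
  "pos_def_sym B \<longleftrightarrow> transpose B = B \<and> (\<forall>v. v \<noteq> 0 \<longrightarrow> v \<bullet> (B *v v) > 0)"

definition metric_tensor ::
  "(real^'n::finite \<Rightarrow> real^'n \<Rightarrow> real) \<Rightarrow> real^'n \<Rightarrow> real^'n \<Rightarrow> real^'n^'n" where
  "metric_tensor F x y = (\<chi> i j. (1/2) * d_y i (d_y j (\<lambda>x y. (F x y)\<^sup>2)) x y)"

definition Finsler_metric ::
  "('m, 'n::finite) chart set \<Rightarrow> (('m, 'n) tvec \<Rightarrow> real) \<Rightarrow> bool" where
  "Finsler_metric \<A> F \<longleftrightarrow>
     (\<forall>c\<in>\<A>.
        (\<forall>x\<in>chart_range c. \<forall>y. in_coords \<A> F c x y \<ge> 0) \<and>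
        smooth_on (chart_range c \<times> (- {0})) (\<lambda>(x, y). in_coords \<A> F c x y) \<and>
        (\<forall>x\<in>chart_range c. \<forall>y. \<forall>t>0.
           in_coords \<A> F c x (t *\<^sub>R y) = t * in_coords \<A> F c x y) \<and>
        (\<forall>x\<in>chart_range c. \<forall>y. y \<noteq> 0 \<longrightarrow> pos_def_sym (metric_tensor (in_coords \<A> F c) x y)))"

text \<open>Polynomials in \<open>y\<close> are finite sums over sets of multi-indices \<open>\<alpha> :: 'n \<Rightarrow> nat\<close>. As usual for
  rational functions, the denominator is only required to be a nonzero polynomial, and the quotient
  representation is required wherever the denominator does not vanish.\<close>

definition poly_eval ::
  "('n::finite \<Rightarrow> nat) set \<Rightarrow> (('n \<Rightarrow> nat) \<Rightarrow> real) \<Rightarrow> real^'n \<Rightarrow> real" where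
  "poly_eval I p y = (\<Sum>\<alpha>\<in>I. p \<alpha> * (\<Prod>i\<in>UNIV. (y $ i) ^ \<alpha> i))"

definition rational_function :: "(real^'n::finite \<Rightarrow> real) \<Rightarrow> bool" where
  "rational_function f \<longleftrightarrow>
     (\<exists>I p q. finite I \<and> (\<exists>\<alpha>\<in>I. q \<alpha> \<noteq> 0) \<and>
        (\<forall>y. y \<noteq> 0 \<and> poly_eval I q y \<noteq> 0 \<longrightarrow> f y = poly_eval I p y / poly_eval I q y))"

definition rational_in_y ::
  "(real^'n::finite) set \<Rightarrow> (real^'n \<Rightarrow> real^'n \<Rightarrow> real) \<Rightarrow> bool" where
  "rational_in_y V f \<longleftrightarrow>
     (\<forall>x0\<in>V. \<exists>W I p q. open W \<and> x0 \<in> W \<and> W \<subseteq> V \<and> finite I \<and>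
        (\<forall>\<alpha>\<in>I. smooth_on W (\<lambda>x. p x \<alpha>) \<and> smooth_on W (\<lambda>x. q x \<alpha>)) \<and>
        (\<forall>x\<in>W. (\<exists>\<alpha>\<in>I. q x \<alpha> \<noteq> 0) \<and>
           (\<forall>y. y \<noteq> 0 \<and> poly_eval I (q x) y \<noteq> 0 \<longrightarrow>
              f x y = poly_eval I (p x) y / poly_eval I (q x) y)))"

text \<open>The decomposition is part of the data: \<open>a c x y\<close> is the matrix \<open>(a\<^sub>i\<^sub>j(x,y))\<close> in the chart
  \<open>c\<close>.\<close>

definition AR_Finsler_metric ::
  "('m, 'n::finite) chart set \<Rightarrow> (('m, 'n) tvec \<Rightarrow> real) \<Rightarrow> (('m, 'n) tvec \<Rightarrow> real) \<Rightarrow>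
     (('m, 'n) chart \<Rightarrow> real^'n \<Rightarrow> real^'n \<Rightarrow> real^'n^'n) \<Rightarrow> bool" where
  "AR_Finsler_metric \<A> F \<eta> a \<longleftrightarrow>
     Finsler_metric \<A> F \<and>
     (\<forall>c\<in>\<A>.
        (\<forall>x\<in>chart_range c. \<forall>y. y \<noteq> 0 \<longrightarrow>
           metric_tensor (in_coords \<A> F c) x y = in_coords \<A> \<eta> c x y *\<^sub>R a c x y) \<and>
        (\<forall>x\<in>chart_range c. \<forall>y. y \<noteq> 0 \<longrightarrow> in_coords \<A> \<eta> c x y \<ge> 0) \<and>
        smooth_on (chart_range c \<times> (- {0})) (\<lambda>(x, y). in_coords \<A> \<eta> c x y) \<and>
        (\<forall>x\<in>chart_range c. \<forall>y. y \<noteq> 0 \<longrightarrow> pos_def_sym (a c x y)) \<and>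
        (\<forall>i j. rational_in_y (chart_range c) (\<lambda>x y. a c x y $ i $ j)) \<and>
        (\<forall>i j. \<forall>x\<in>chart_range c. \<forall>y. y \<noteq> 0 \<longrightarrow> (\<forall>t>0.
           in_coords \<A> \<eta> c x (t *\<^sub>R y) * a c x (t *\<^sub>R y) $ i $ j =
           in_coords \<A> \<eta> c x y * a c x y $ i $ j)))"

definition spray_coeff ::
  "(real^'n::finite \<Rightarrow> real^'n \<Rightarrow> real) \<Rightarrow> 'n \<Rightarrow> real^'n \<Rightarrow> real^'n \<Rightarrow> real" where
  "spray_coeff F i x y =
     (1/4) * (\<Sum>r\<in>UNIV. matrix_inv (metric_tensor F x y) $ i $ r *
        ((\<Sum>k\<in>UNIV. y $ k * d_y r (d_x k (\<lambda>x y. (F x y)\<^sup>2)) x y)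
          - d_x r (\<lambda>x y. (F x y)\<^sup>2) x y))"

definition Barthel_connection ::
  "(real^'n::finite \<Rightarrow> real^'n \<Rightarrow> real) \<Rightarrow> 'n \<Rightarrow> 'n \<Rightarrow> real^'n \<Rightarrow> real^'n \<Rightarrow> real" where
  "Barthel_connection F i j = d_y j (spray_coeff F i)"

text \<open>\<open>\<sigma> c\<close> is the coefficient of the volume form in the chart \<open>c\<close>. The absolute value of the
  Jacobian determinant keeps \<open>\<sigma>\<close> positive in every chart; it is redundant for an oriented atlas,
  and on non-orientable manifolds gives densities.\<close>

definition volume_form ::
  "('m, 'n::finite) chart set \<Rightarrow> (('m, 'n) chart \<Rightarrow> real^'n \<Rightarrow> real) \<Rightarrow> bool" where
  "volume_form \<A> \<sigma> \<longleftrightarrow>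
     (\<forall>c\<in>\<A>. smooth_on (chart_range c) (\<sigma> c) \<and> (\<forall>x\<in>chart_range c. \<sigma> c x > 0)) \<and>
     (\<forall>c\<in>\<A>. \<forall>d\<in>\<A>. \<forall>x\<in>snd c ` (fst c \<inter> fst d).
        \<sigma> c x = \<bar>det (matrix (frechet_derivative (transition c d) (at x)))\<bar>
                  * \<sigma> d (transition c d x))"

definition S_curvature ::
  "('m, 'n::finite) chart set \<Rightarrow> (('m, 'n) tvec \<Rightarrow> real) \<Rightarrow>
     (('m, 'n) chart \<Rightarrow> real^'n \<Rightarrow> real) \<Rightarrow> ('m, 'n) chart \<Rightarrow> real^'n \<Rightarrow> real^'n \<Rightarrow> real" where
  "S_curvature \<A> F \<sigma> c x y =
     (\<Sum>m\<in>UNIV. Barthel_connection (in_coords \<A> F c) m m x y)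
     - (\<Sum>m\<in>UNIV. y $ m * d_x m (\<lambda>x y. ln (\<sigma> c x)) x y)"

definition isotropic_S_curvature ::
  "('m, 'n::finite) chart set \<Rightarrow> (('m, 'n) tvec \<Rightarrow> real) \<Rightarrow>
     (('m, 'n) chart \<Rightarrow> real^'n \<Rightarrow> real) \<Rightarrow> bool" where
  "isotropic_S_curvature \<A> F \<sigma> \<longleftrightarrow>
     (\<exists>A. \<forall>c\<in>\<A>. \<forall>x\<in>chart_range c. \<forall>y. y \<noteq> 0 \<longrightarrow>
        S_curvature \<A> F \<sigma> c x y =
          (real CARD('n) + 1) * A (chart_inv c x) * in_coords \<A> F c x y)"

end

theory Submission
  imports Defs
begin

text \<open>By Euler's theorem \<open>F\<^sup>2 = \<eta> a\<^sub>i\<^sub>j y\<^sup>i y\<^sup>j\<close>, so that every derivative of \<open>F\<^sup>2\<close> entering the spray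
  coefficients is \<open>\<eta>\<close> times a rational function of \<open>y\<close>: the logarithmic derivatives of \<open>\<eta>\<close> in \<open>x\<close> are
  rational by hypothesis, those in \<open>y\<close> because \<open>\<partial>F\<^sup>2/\<partial>y\<^sup>r = 2 \<eta> a\<^sub>r\<^sub>j y\<^sup>j\<close>. The factor \<open>\<eta>\<close> cancels against
  the inverse of \<open>g\<^sub>i\<^sub>j = \<eta> a\<^sub>i\<^sub>j\<close>, so the spray coefficients and hence the \<open>S\<close>-curvature are rational in
  \<open>y\<close>. If \<open>S = (n + 1) A F\<close> with \<open>A \<noteq> 0\<close> at a point, then \<open>F\<close> would be rational there.

  All identities between rational functions are only needed off the zero set of some nonzero
  polynomial in \<open>y\<close>. This set is open and dense, so there one may differentiate such identities.\<close>

section \<open>Generic properties and rational functions\<close>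

text \<open>The exceptional set is confined to the zeros of one polynomial rather than to a null or
  meagre set. Multiplying the polynomials then handles finite conjunctions, and polynomial
  denominators are covered directly.\<close>

definition generically :: "(real^'n::finite \<Rightarrow> bool) \<Rightarrow> bool" where
  "generically P \<longleftrightarrow>
     (\<exists>Q. real_polynomial_function Q \<and> (\<exists>y. Q y \<noteq> 0) \<and> (\<forall>y. Q y \<noteq> 0 \<longrightarrow> P y))"

text \<open>On the line through \<open>a\<close> and \<open>b\<close> both polynomials become
  polynomials in one real variable. \<open>P\<close> is nonzero at parameter 0 and \<open>Q\<close>
  at parameter 1, so each has finitely many zeros there, and some parameter avoids all of
  them.\<close>

lemma real_polynomial_function_mult_nonzero:
  fixes P Q :: "'a::real_normed_vector \<Rightarrow> real"
  assumes P: "real_polynomial_function P" and Q: "real_polynomial_function Q"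
    and "P a \<noteq> 0" "Q b \<noteq> 0"
  shows "\<exists>y. P y * Q y \<noteq> 0"
proof -
  define l where "l t = a + t *\<^sub>R (b - a)" for t :: real
  have l: "polynomial_function l"
    unfolding l_def
    by (intro polynomial_function_add polynomial_function_mult polynomial_function_const)
      (simp_all add: polynomial_function_id)
  have fin: "finite {t. (R \<circ> l) t = 0}"
    if "real_polynomial_function R" and nz: "R (l s) \<noteq> 0" for R :: "'a \<Rightarrow> real" and s
  proof -
    have "real_polynomial_function (R \<circ> l)"
      using l that(1) by (rule real_polynomial_function_compose)
    then obtain c n where c: "R \<circ> l = (\<lambda>t. \<Sum>i\<le>n. c i * t ^ i)"
      using real_polynomial_function_imp_sum by blast
    have "\<exists>i\<le>n. c i \<noteq> 0"
    proof (rule ccontr)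
      assume "\<not> ?thesis"
      then have "(R \<circ> l) s = 0" unfolding c by simp
      with nz show False by simp
    qed
    then show ?thesis
      unfolding c using polyfun_rootbound by blast
  qed
  have "finite ({t. (P \<circ> l) t = 0} \<union> {t. (Q \<circ> l) t = 0})"
    using fin[OF P, of 0] fin[OF Q, of 1] assms(3,4) by (simp add: l_def)
  then obtain t where "t \<notin> {t. (P \<circ> l) t = 0} \<union> {t. (Q \<circ> l) t = 0}"
    using ex_new_if_finite infinite_UNIV_char_0 by blast
  then show ?thesis by auto
qed

lemma generically_mono: "generically P \<Longrightarrow> (\<And>y. P y \<Longrightarrow> R y) \<Longrightarrow> generically R"
  unfolding generically_def by blast

lemma generically_conj:
  assumes "generically P" "generically R"
  shows "generically (\<lambda>y. P y \<and> R y)"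
proof -
  obtain Q Q' where Q: "real_polynomial_function Q" "real_polynomial_function Q'"
    and nz: "\<exists>y. Q y \<noteq> 0" "\<exists>y. Q' y \<noteq> 0"
    and imp: "\<forall>y. Q y \<noteq> 0 \<longrightarrow> P y" "\<forall>y. Q' y \<noteq> 0 \<longrightarrow> R y"
    using assms unfolding generically_def by blast
  have "real_polynomial_function (\<lambda>y. Q y * Q' y)"
    using Q by (rule real_polynomial_function.intros(4))
  moreover have "\<exists>y. Q y * Q' y \<noteq> 0"
    using Q nz real_polynomial_function_mult_nonzero by blast
  ultimately show ?thesis
    unfolding generically_def using imp by (intro exI[of _ "\<lambda>y. Q y * Q' y"]) auto
qed

lemma generically_True: "generically (\<lambda>y. True)"
  unfolding generically_def by (intro exI[of _ "\<lambda>y. 1"]) (auto intro: real_polynomial_function.intros(2))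

lemma generically_all_finite:
  fixes P :: "'i::finite \<Rightarrow> real^'n::finite \<Rightarrow> bool"
  assumes "\<And>i. generically (P i)"
  shows "generically (\<lambda>y. \<forall>i. P i y)"
proof -
  have "generically (\<lambda>y. \<forall>i\<in>S. P i y)" if "finite S" for S
    using that
  proof induction
    case empty
    then show ?case by (simp add: generically_True)
  next
    case (insert i S)
    then show ?case
      using generically_conj[OF assms[of i] insert.IH] by simp
  qed
  from this[of UNIV] show ?thesis by simp
qed

lemma generically_nonzero: "generically (\<lambda>y. y \<noteq> 0)"
proof -
  have "real_polynomial_function (\<lambda>y::real^'a. y $ i)" for i
    by (intro real_polynomial_function.intros(1) bounded_linear_vec_nth)
  moreover have "(axis i 1 :: real^'a) $ i \<noteq> 0" for i
    by (simp add: axis_def)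
  \<comment> \<open>A single coordinate suffices, since it vanishes at the origin;
    \<open>undefined\<close> is just some index.\<close>
  ultimately show ?thesis
    unfolding generically_def
    by (intro exI[of _ "\<lambda>y. y $ undefined"] conjI exI[of _ "axis undefined 1"]) auto
qed

text \<open>The set where a polynomial does not vanish is open. This is what permits differentiating
  an identity that holds only generically.\<close>

lemma generically_nhds:
  assumes "generically P"
  shows "generically (\<lambda>y. eventually P (nhds y))"
proof -
  obtain Q where Q: "real_polynomial_function Q" "\<exists>y. Q y \<noteq> 0" "\<forall>y. Q y \<noteq> 0 \<longrightarrow> P y"
    using assms unfolding generically_def by blast
  have "continuous_on UNIV Q"
    using Q(1) continuous_real_polymonial_function continuous_at_imp_continuous_on by blast
  then have "open {y. Q y \<noteq> 0}"
    by (intro open_Collect_neq continuous_on_const)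
  then have "eventually P (nhds y)" if "Q y \<noteq> 0" for y
    using that Q(3) by (auto simp: eventually_nhds)
  then show ?thesis
    using Q(1,2) unfolding generically_def by blast
qed

text \<open>Counterpart of \<open>rational_function\<close> with abstract polynomials instead of
  sums over multi-indices, for which closure properties are easier to show. Including
  \<open>y = 0\<close> is no restriction, because the denominator can be multiplied by a
  coordinate.\<close>

definition gen_rational :: "(real^'n::finite \<Rightarrow> real) \<Rightarrow> bool" where
  "gen_rational f \<longleftrightarrow>
     (\<exists>P Q. real_polynomial_function P \<and> real_polynomial_function Q \<and> (\<exists>y. Q y \<noteq> 0) \<and>
        (\<forall>y. Q y \<noteq> 0 \<longrightarrow> f y = P y / Q y))"

text \<open>Multiplying numerator and denominator by a further polynomial shrinks the set on which the
  quotient has to represent the function.\<close>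

lemma gen_rationalI:
  assumes P: "real_polynomial_function P" and Q: "real_polynomial_function Q"
    and nz: "\<exists>y. Q y \<noteq> 0" and eq: "generically (\<lambda>y. Q y \<noteq> 0 \<longrightarrow> f y = P y / Q y)"
  shows "gen_rational f"
proof -
  obtain R where R: "real_polynomial_function R" "\<exists>y. R y \<noteq> 0"
    "\<forall>y. R y \<noteq> 0 \<longrightarrow> Q y \<noteq> 0 \<longrightarrow> f y = P y / Q y"
    using eq unfolding generically_def by blast
  have "\<exists>y. Q y * R y \<noteq> 0"
    using Q R nz real_polynomial_function_mult_nonzero by blast
  moreover have "real_polynomial_function (\<lambda>y. P y * R y)" "real_polynomial_function (\<lambda>y. Q y * R y)"
    using P Q R by auto
  ultimately show ?thesis
    unfolding gen_rational_def
    by (intro exI[of _ "\<lambda>y. P y * R y"] exI[of _ "\<lambda>y. Q y * R y"]) (use R in auto)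
qed

lemma gen_rationalE:
  assumes "gen_rational f"
  obtains P Q where "real_polynomial_function P" "real_polynomial_function Q" "\<exists>y. Q y \<noteq> 0"
    "generically (\<lambda>y. Q y \<noteq> 0 \<and> f y = P y / Q y)"
  using assms unfolding gen_rational_def generically_def by blast

text \<open>Values on the exceptional set do not matter, so default values of derivatives, quotients
  and matrix inverses there are harmless.\<close>

lemma gen_rational_cong:
  assumes "gen_rational f" "generically (\<lambda>y. g y = f y)"
  shows "gen_rational g"
proof -
  obtain P Q where PQ: "real_polynomial_function P" "real_polynomial_function Q" "\<exists>y. Q y \<noteq> 0"
    "generically (\<lambda>y. Q y \<noteq> 0 \<and> f y = P y / Q y)"
    using assms(1) by (rule gen_rationalE)
  show ?thesis
    by (rule gen_rationalI[OF PQ(1-3)])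
      (rule generically_mono[OF generically_conj[OF PQ(4) assms(2)]], auto)
qed

lemma gen_rational_polynomial: "real_polynomial_function P \<Longrightarrow> gen_rational P"
  unfolding gen_rational_def
  by (intro exI[of _ P] exI[of _ "\<lambda>y. 1"]) auto

lemma gen_rational_const: "gen_rational (\<lambda>y. c)"
  by (intro gen_rational_polynomial real_polynomial_function.intros(2))

lemma gen_rational_nth: "gen_rational (\<lambda>y. y $ i)"
  by (intro gen_rational_polynomial real_polynomial_function.intros(1) bounded_linear_vec_nth)

lemma gen_rational_add:
  assumes "gen_rational f" "gen_rational g"
  shows "gen_rational (\<lambda>y. f y + g y)"
proof -
  obtain P Q where f: "real_polynomial_function P" "real_polynomial_function Q" "\<exists>y. Q y \<noteq> 0"
    "generically (\<lambda>y. Q y \<noteq> 0 \<and> f y = P y / Q y)"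
    using assms(1) by (rule gen_rationalE)
  obtain P' Q' where g: "real_polynomial_function P'" "real_polynomial_function Q'" "\<exists>y. Q' y \<noteq> 0"
    "generically (\<lambda>y. Q' y \<noteq> 0 \<and> g y = P' y / Q' y)"
    using assms(2) by (rule gen_rationalE)
  show ?thesis
  proof (rule gen_rationalI)
    show "real_polynomial_function (\<lambda>y. P y * Q' y + P' y * Q y)"
      "real_polynomial_function (\<lambda>y. Q y * Q' y)"
      using f g by auto
    show "\<exists>y. Q y * Q' y \<noteq> 0"
      using f g real_polynomial_function_mult_nonzero by blast
    show "generically (\<lambda>y. Q y * Q' y \<noteq> 0 \<longrightarrow>
        f y + g y = (P y * Q' y + P' y * Q y) / (Q y * Q' y))"
      by (rule generically_mono[OF generically_conj[OF f(4) g(4)]]) (simp add: add_frac_eq)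
  qed
qed

lemma gen_rational_mult:
  assumes "gen_rational f" "gen_rational g"
  shows "gen_rational (\<lambda>y. f y * g y)"
proof -
  obtain P Q where f: "real_polynomial_function P" "real_polynomial_function Q" "\<exists>y. Q y \<noteq> 0"
    "generically (\<lambda>y. Q y \<noteq> 0 \<and> f y = P y / Q y)"
    using assms(1) by (rule gen_rationalE)
  obtain P' Q' where g: "real_polynomial_function P'" "real_polynomial_function Q'" "\<exists>y. Q' y \<noteq> 0"
    "generically (\<lambda>y. Q' y \<noteq> 0 \<and> g y = P' y / Q' y)"
    using assms(2) by (rule gen_rationalE)
  show ?thesis
  proof (rule gen_rationalI)
    show "real_polynomial_function (\<lambda>y. P y * P' y)"
      "real_polynomial_function (\<lambda>y. Q y * Q' y)"
      using f g by auto
    show "\<exists>y. Q y * Q' y \<noteq> 0"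
      using f g real_polynomial_function_mult_nonzero by blast
    show "generically (\<lambda>y. Q y * Q' y \<noteq> 0 \<longrightarrow> f y * g y = P y * P' y / (Q y * Q' y))"
      by (rule generically_mono[OF generically_conj[OF f(4) g(4)]]) simp
  qed
qed

text \<open>The case where \<open>f\<close> vanishes generically relies on \<open>inverse 0 = 0\<close>.\<close>

lemma gen_rational_inverse:
  assumes "gen_rational f"
  shows "gen_rational (\<lambda>y. inverse (f y))"
proof -
  obtain P Q where f: "real_polynomial_function P" "real_polynomial_function Q" "\<exists>y. Q y \<noteq> 0"
    "generically (\<lambda>y. Q y \<noteq> 0 \<and> f y = P y / Q y)"
    using assms by (rule gen_rationalE)
  show ?thesis
  proof (cases "\<exists>y. P y \<noteq> 0")
    case True
    show ?thesis
      by (rule gen_rationalI[OF f(2,1) True], rule generically_mono[OF f(4)]) simp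
  next
    case False
    show ?thesis
      by (rule gen_rational_cong[OF gen_rational_const[of 0]], rule generically_mono[OF f(4)])
        (use False in simp)
  qed
qed

lemma gen_rational_divide:
  "gen_rational f \<Longrightarrow> gen_rational g \<Longrightarrow> gen_rational (\<lambda>y. f y / g y)"
  unfolding divide_inverse by (intro gen_rational_mult gen_rational_inverse)

lemma gen_rational_diff:
  "gen_rational f \<Longrightarrow> gen_rational g \<Longrightarrow> gen_rational (\<lambda>y. f y - g y)"
  using gen_rational_add[of f "\<lambda>y. (-1) * g y"] gen_rational_mult[OF gen_rational_const[of "-1"], of g]
  by simp

lemma gen_rational_sum:
  "(\<And>i. i \<in> S \<Longrightarrow> gen_rational (f i)) \<Longrightarrow> gen_rational (\<lambda>y. \<Sum>i\<in>S. f i y)"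
  by (induction S rule: infinite_finite_induct) (auto intro: gen_rational_const gen_rational_add)

lemma gen_rational_prod:
  "(\<And>i. i \<in> S \<Longrightarrow> gen_rational (f i)) \<Longrightarrow> gen_rational (\<lambda>y. \<Prod>i\<in>S. f i y)"
  by (induction S rule: infinite_finite_induct) (auto intro: gen_rational_const gen_rational_mult)

lemmas gen_rational_intros = gen_rational_const gen_rational_nth gen_rational_add
  gen_rational_diff gen_rational_mult gen_rational_divide gen_rational_sum gen_rational_prod

section \<open>Determinants and inverses of matrices with rational entries\<close>

lemma gen_rational_det:
  assumes "\<And>i j. gen_rational (\<lambda>y. B y $ i $ j)"
  shows "gen_rational (\<lambda>y. det (B y))"
  unfolding det_def by (intro gen_rational_intros assms)

text \<open>Cramer's rule for \<open>B *v z = axis r 1\<close>, whose solution is column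
  \<open>r\<close> of the inverse. Both determinants are polynomial in the entries of
  \<open>B\<close>.\<close>

lemma matrix_inv_nth_eq_det:
  fixes B :: "real^'n^'n"
  assumes "det B \<noteq> 0"
  shows "matrix_inv B $ i $ r = det (\<chi> k j. if j = i then axis r 1 $ k else B $ k $ j) / det B"
proof -
  have "B ** matrix_inv B = mat 1"
    using assms unfolding invertible_det_nz[symmetric] invertible_def matrix_inv_def
    by (rule someI2_ex) simp
  then have "B *v (matrix_inv B *v axis r 1) = axis r 1"
    by (simp add: matrix_vector_mul_assoc)
  then have "matrix_inv B *v axis r 1 =
      (\<chi> i. det (\<chi> k j. if j = i then axis r 1 $ k else B $ k $ j) / det B)"
    using cramer[OF assms] by blast
  moreover have "(matrix_inv B *v axis r 1) $ i = matrix_inv B $ i $ r"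
    by (simp add: matrix_vector_mul_component inner_axis)
  ultimately show ?thesis by simp
qed

lemma gen_rational_matrix_inv:
  assumes "\<And>i j. gen_rational (\<lambda>y. B y $ i $ j)" and "generically (\<lambda>y. det (B y) \<noteq> 0)"
  shows "gen_rational (\<lambda>y. matrix_inv (B y) $ i $ r)"
proof (rule gen_rational_cong)
  show "gen_rational
      (\<lambda>y. det (\<chi> k j. if j = i then axis r 1 $ k else B y $ k $ j) / det (B y))"
  proof (intro gen_rational_divide gen_rational_det assms(1))
    show "gen_rational (\<lambda>y. (\<chi> k j. if j = i then axis r 1 $ k else B y $ k $ j) $ k $ j)" for k j
      using assms(1) by (cases "j = i") (simp_all add: gen_rational_const)
  qed
  show "generically (\<lambda>y. matrix_inv (B y) $ i $ r =
      det (\<chi> k j. if j = i then axis r 1 $ k else B y $ k $ j) / det (B y))"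
    using assms(2) by (rule generically_mono) (rule matrix_inv_nth_eq_det)
qed

section \<open>Directional derivatives\<close>

text \<open>The one-variable form matches the argument of \<open>deriv\<close> in \<open>d_x\<close>
  and \<open>d_y\<close>, and makes the calculus rules for real functions applicable.\<close>

abbreviation has_dir_deriv :: "('a::real_normed_vector \<Rightarrow> real) \<Rightarrow> 'a \<Rightarrow> 'a \<Rightarrow> real \<Rightarrow> bool" where
  "has_dir_deriv f y v D \<equiv> ((\<lambda>t. f (y + t *\<^sub>R v)) has_real_derivative D) (at 0)"

lemma has_dir_deriv_cong:
  assumes "has_dir_deriv f y v D" "eventually (\<lambda>z. g z = f z) (nhds y)"
  shows "has_dir_deriv g y v D"
proof -
  have "isCont (\<lambda>t. y + t *\<^sub>R v) 0"
    by (intro continuous_intros)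
  then have "filterlim (\<lambda>t. y + t *\<^sub>R v) (nhds y) (nhds 0)"
    unfolding isCont_def using tendsto_at_iff_tendsto_nhds[of "\<lambda>t. y + t *\<^sub>R v" 0] by simp
  then have "eventually (\<lambda>t. g (y + t *\<^sub>R v) = f (y + t *\<^sub>R v)) (nhds 0)"
    using assms(2) by (rule eventually_compose_filterlim[rotated])
  then show ?thesis
    using assms(1) by (simp add: DERIV_cong_ev)
qed

lemma real_polynomial_function_dir_deriv:
  fixes P :: "'a::real_normed_vector \<Rightarrow> real"
  assumes "real_polynomial_function P"
  shows "\<exists>P'. real_polynomial_function P' \<and> (\<forall>y. has_dir_deriv P y v (P' y))"
  using assms
proof induction
  case (linear f)
  then interpret bounded_linear f .
  have "has_dir_deriv f y v (f v)" for y
    by (auto simp: add scale intro!: derivative_eq_intros)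
  then show ?case by blast
next
  case (const c)
  show ?case by (intro exI[of _ "\<lambda>y. 0"]) auto
next
  case (add f g)
  then obtain f' g' where "real_polynomial_function f'" "real_polynomial_function g'"
    "\<forall>y. has_dir_deriv f y v (f' y)" "\<forall>y. has_dir_deriv g y v (g' y)"
    by blast
  then show ?case
    by (intro exI[of _ "\<lambda>y. f' y + g' y"]) (auto intro: derivative_intros)
next
  case (mult f g)
  then obtain f' g' where *: "real_polynomial_function f'" "real_polynomial_function g'"
    "\<forall>y. has_dir_deriv f y v (f' y)" "\<forall>y. has_dir_deriv g y v (g' y)"
    by blast
  have "has_dir_deriv (\<lambda>y. f y * g y) y v (f' y * g y + g' y * f y)" for y
    using DERIV_mult[OF *(3)[rule_format, of y] *(4)[rule_format, of y]] by simp
  then show ?case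
    using * mult.hyps
    by (intro exI[of _ "\<lambda>y. f' y * g y + g' y * f y"]) auto
qed

lemma has_dir_deriv_divide:
  assumes "has_dir_deriv P y v P'" "has_dir_deriv Q y v Q'" "Q y \<noteq> 0"
  shows "has_dir_deriv (\<lambda>y. P y / Q y) y v ((P' * Q y - P y * Q') / (Q y * Q y))"
  using DERIV_divide[OF assms(1,2)] assms(3) by simp

text \<open>The quotient rule applies on the open set where \<open>f\<close> agrees with a quotient
  of polynomials; elsewhere \<open>f\<close> may fail to be differentiable.\<close>

lemma gen_rational_dir_deriv:
  assumes "gen_rational f"
  shows "\<exists>g. gen_rational g \<and> generically (\<lambda>y. has_dir_deriv f y v (g y))"
proof -
  obtain P Q where f: "real_polynomial_function P" "real_polynomial_function Q" "\<exists>y. Q y \<noteq> 0"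
    "generically (\<lambda>y. Q y \<noteq> 0 \<and> f y = P y / Q y)"
    using assms by (rule gen_rationalE)
  obtain P' where P': "real_polynomial_function P'" "\<forall>y. has_dir_deriv P y v (P' y)"
    using real_polynomial_function_dir_deriv[OF f(1)] by blast
  obtain Q' where Q': "real_polynomial_function Q'" "\<forall>y. has_dir_deriv Q y v (Q' y)"
    using real_polynomial_function_dir_deriv[OF f(2)] by blast
  let ?g = "\<lambda>y. (P' y * Q y - P y * Q' y) / (Q y * Q y)"
  have "gen_rational ?g"
    using P' Q' f by (intro gen_rational_intros gen_rational_polynomial)
  moreover have "generically (\<lambda>y. has_dir_deriv f y v (?g y))"
  proof (rule generically_mono[OF generically_conj[OF f(4) generically_nhds[OF f(4)]]])
    fix y assume y: "(Q y \<noteq> 0 \<and> f y = P y / Q y) \<and> (\<forall>\<^sub>F y in nhds y. Q y \<noteq> 0 \<and> f y = P y / Q y)"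
    have "has_dir_deriv (\<lambda>y. P y / Q y) y v (?g y)"
      using y P' Q' by (intro has_dir_deriv_divide) auto
    then show "has_dir_deriv f y v (?g y)"
      by (rule has_dir_deriv_cong) (use y in \<open>auto elim: eventually_mono\<close>)
  qed
  ultimately show ?thesis by (intro exI[of _ ?g]) simp
qed

section \<open>Polynomials in coordinates\<close>

lemma real_polynomial_function_poly_eval: "real_polynomial_function (poly_eval I p)"
proof -
  have nth: "real_polynomial_function (\<lambda>y::real^'a. y $ i)" for i
    by (intro real_polynomial_function.intros(1) bounded_linear_vec_nth)
  have "real_polynomial_function (\<lambda>y. \<Sum>\<alpha>\<in>I. p \<alpha> * (\<Prod>i\<in>UNIV. (y $ i) ^ \<alpha> i))"
  proof (cases "finite I")
    case True
    then show ?thesis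
      by (intro real_polynomial_function_sum real_polynomial_function.intros(2,4)
          real_polynomial_function_prod real_polynomial_function_power nth finite_class.finite_UNIV)
  qed (simp add: real_polynomial_function.intros(2))
  then show ?thesis unfolding poly_eval_def .
qed

text \<open>Both coefficient families are extended by zero to the union of the index sets.\<close>

lemma poly_eval_add:
  assumes "finite I" "finite J"
  shows "poly_eval I p y + poly_eval J q y =
    poly_eval (I \<union> J) (\<lambda>\<alpha>. (if \<alpha> \<in> I then p \<alpha> else 0) + (if \<alpha> \<in> J then q \<alpha> else 0)) y"
proof -
  have "poly_eval I p y = poly_eval (I \<union> J) (\<lambda>\<alpha>. if \<alpha> \<in> I then p \<alpha> else 0) y"
    "poly_eval J q y = poly_eval (I \<union> J) (\<lambda>\<alpha>. if \<alpha> \<in> J then q \<alpha> else 0) y"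
    unfolding poly_eval_def using assms by (auto intro!: sum.mono_neutral_cong_left)
  then show ?thesis
    by (simp add: poly_eval_def sum.distrib distrib_right)
qed

lemma poly_eval_superset:
  assumes "finite J" "I \<subseteq> J"
  shows "poly_eval I p = poly_eval J (\<lambda>\<alpha>. if \<alpha> \<in> I then p \<alpha> else 0)"
  unfolding poly_eval_def fun_eq_iff using assms by (auto intro!: sum.mono_neutral_cong_left)

lemma poly_eval_sum_ex:
  assumes "finite A" "\<And>k. k \<in> A \<Longrightarrow> \<exists>I p. finite I \<and> f k = poly_eval I p"
  shows "\<exists>I p. finite I \<and> (\<lambda>y. \<Sum>k\<in>A. f k y) = poly_eval I p"
  using assms
proof (induction A)
  case empty
  then show ?case by (intro exI[of _ "{}"]) (simp add: poly_eval_def fun_eq_iff)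
next
  case (insert k A)
  obtain I p where I: "finite I" "f k = poly_eval I p"
    using insert.prems[of k] by auto
  obtain J q where J: "finite J" "(\<lambda>y. \<Sum>k\<in>A. f k y) = poly_eval J q"
    using insert.IH insert.prems by blast
  have "(\<lambda>y. \<Sum>k\<in>insert k A. f k y) = (\<lambda>y. poly_eval I p y + poly_eval J q y)"
    using insert.hyps I fun_cong[OF J(2)] by simp
  also have "\<dots> = poly_eval (I \<union> J)
      (\<lambda>\<alpha>. (if \<alpha> \<in> I then p \<alpha> else 0) + (if \<alpha> \<in> J then q \<alpha> else 0))"
    using I(1) J(1) by (simp add: poly_eval_add fun_eq_iff)
  finally show ?case using I(1) J(1) by blast
qed

text \<open>Induction over the construction of polynomials: a linear form is expanded in the
  standard basis, and a product is multiplied out into monomials.\<close>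

lemma real_polynomial_function_imp_poly_eval:
  fixes P :: "real^'n::finite \<Rightarrow> real"
  assumes "real_polynomial_function P"
  shows "\<exists>I p. finite I \<and> P = poly_eval I p"
  using assms
proof induction
  case (linear f)
  then interpret bounded_linear f .
  have "\<exists>I p. finite I \<and> (\<lambda>y. f (axis i 1) * y $ i) = poly_eval I p" for i
  proof -
    have "(\<Prod>j\<in>UNIV. (y $ j) ^ (if j = i then 1 else 0)) = y $ i" for y :: "real^'n"
      by (simp add: if_distrib[of "power _"] cong: if_cong)
    then show ?thesis
      by (intro exI[of _ "{\<lambda>j. if j = i then 1 else 0}"] exI[of _ "\<lambda>\<alpha>. f (axis i 1)"])
        (simp add: poly_eval_def fun_eq_iff)
  qed
  then have "\<exists>I p. finite I \<and> (\<lambda>y. \<Sum>i\<in>UNIV. f (axis i 1) * y $ i) = poly_eval I p"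
    by (intro poly_eval_sum_ex) auto
  then obtain I p where I: "finite I" "(\<lambda>y. \<Sum>i\<in>UNIV. f (axis i 1) * y $ i) = poly_eval I p"
    by blast
  have "f y = (\<Sum>i\<in>UNIV. f (axis i 1) * y $ i)" for y
  proof -
    have "f y = f (\<Sum>i\<in>UNIV. y $ i *\<^sub>R axis i 1)"
      by (simp add: basis_expansion scalar_mult_eq_scaleR[symmetric])
    then show ?thesis
      by (simp only: sum scale real_scaleR_def mult.commute)
  qed
  then have "f = poly_eval I p"
    using I(2) by (rule ext[THEN trans])
  then show ?case using I(1) by blast
next
  case (const c)
  show ?case
    by (intro exI[of _ "{\<lambda>j. 0}"] exI[of _ "\<lambda>\<alpha>. c"]) (simp add: poly_eval_def fun_eq_iff)
next
  case (add f g)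
  \<comment> \<open>Indexing by booleans keeps two summands even if \<open>f = g\<close>.\<close>
  then show ?case
    using poly_eval_sum_ex[of "{True, False}" "\<lambda>b. if b then f else g"] by simp
next
  case (mult f g)
  then obtain I p J q where *: "finite I" "f = poly_eval I p" "finite J" "g = poly_eval J q"
    by blast
  \<comment> \<open>Different pairs of multi-indices may have the same sum. Each product of
    monomials therefore gets its own singleton index set, and \<open>poly_eval_sum_ex\<close>
    collects equal exponents.\<close>
  have "\<exists>K r. finite K \<and> (\<lambda>y. p (fst \<gamma>) * q (snd \<gamma>) * (\<Prod>i\<in>UNIV. (y $ i) ^ (fst \<gamma> i + snd \<gamma> i)))
      = poly_eval K r" for \<gamma>
    by (intro exI[of _ "{\<lambda>i. fst \<gamma> i + snd \<gamma> i}"] exI[of _ "\<lambda>_. p (fst \<gamma>) * q (snd \<gamma>)"])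
      (simp add: poly_eval_def fun_eq_iff)
  then have "\<exists>K r. finite K \<and> (\<lambda>y. \<Sum>\<gamma>\<in>I \<times> J. p (fst \<gamma>) * q (snd \<gamma>) *
      (\<Prod>i\<in>UNIV. (y $ i) ^ (fst \<gamma> i + snd \<gamma> i))) = poly_eval K r"
    using * by (intro poly_eval_sum_ex) auto
  moreover have "f y * g y = (\<Sum>\<gamma>\<in>I \<times> J. p (fst \<gamma>) * q (snd \<gamma>) *
      (\<Prod>i\<in>UNIV. (y $ i) ^ (fst \<gamma> i + snd \<gamma> i)))" for y
    unfolding * poly_eval_def sum_product sum.cartesian_product
    by (intro sum.cong) (auto simp: power_add prod.distrib)
  ultimately show ?case by simp
qed

text \<open>Induction on the number of variables: a polynomial that vanishes identically has, as a
  polynomial in its last variable, vanishing coefficients.\<close>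

lemma monomial_sum_eq_0_imp_coeff_eq_0:
  fixes p :: "('n::finite \<Rightarrow> nat) \<Rightarrow> real"
  assumes "finite S" "finite I"
    and "\<And>\<alpha> \<beta>. \<alpha> \<in> I \<Longrightarrow> \<beta> \<in> I \<Longrightarrow> (\<forall>i\<in>S. \<alpha> i = \<beta> i) \<Longrightarrow> \<alpha> = \<beta>"
    and "\<And>y::real^'n. (\<Sum>\<alpha>\<in>I. p \<alpha> * (\<Prod>i\<in>S. (y $ i) ^ \<alpha> i)) = 0"
    and "\<alpha> \<in> I"
  shows "p \<alpha> = 0"
  using assms
proof (induction S arbitrary: I)
  case empty
  then have "I = {\<alpha>}" by auto
  then show ?case using empty.prems(3) by simp
next
  case (insert j S)
  define J where "J k = {\<alpha> \<in> I. \<alpha> j = k}" for k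
  obtain N where N: "(\<lambda>\<alpha>. \<alpha> j) ` I \<subseteq> {..N}"
    using finite_nat_set_iff_bounded_le[of "(\<lambda>\<alpha>. \<alpha> j) ` I"] insert.prems(1) by auto
  have zero: "(\<Sum>\<alpha>\<in>J k. p \<alpha> * (\<Prod>i\<in>S. (y $ i) ^ \<alpha> i)) = 0" if "k \<le> N" for k and y :: "real^'n"
  proof (rule zero_polynom_imp_zero_coeffs[OF _ that])
    fix t :: real
    \<comment> \<open>With the other coordinates frozen at those of \<open>y\<close>, the sum is a
      polynomial in \<open>t\<close>; its coefficient at \<open>t ^ k\<close> is the part of the sum
      over \<open>J k\<close>.\<close>
    define z :: "real^'n" where "z = (\<chi> i. if i = j then t else y $ i)"
    have "(\<Sum>k\<le>N. (\<Sum>\<alpha>\<in>J k. p \<alpha> * (\<Prod>i\<in>S. (y $ i) ^ \<alpha> i)) * t ^ k) =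
        (\<Sum>k\<le>N. \<Sum>\<alpha>\<in>J k. p \<alpha> * (\<Prod>i\<in>insert j S. (z $ i) ^ \<alpha> i))"
    proof (rule sum.cong[OF refl])
      fix k
      have "(\<Prod>i\<in>insert j S. (z $ i) ^ \<alpha> i) = t ^ k * (\<Prod>i\<in>S. (y $ i) ^ \<alpha> i)" if "\<alpha> \<in> J k" for \<alpha>
      proof -
        have "(\<Prod>i\<in>S. (z $ i) ^ \<alpha> i) = (\<Prod>i\<in>S. (y $ i) ^ \<alpha> i)"
          using insert.hyps by (intro prod.cong) (auto simp: z_def)
        then show ?thesis
          using that insert.hyps by (simp add: J_def z_def)
      qed
      then show "(\<Sum>\<alpha>\<in>J k. p \<alpha> * (\<Prod>i\<in>S. (y $ i) ^ \<alpha> i)) * t ^ k =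
          (\<Sum>\<alpha>\<in>J k. p \<alpha> * (\<Prod>i\<in>insert j S. (z $ i) ^ \<alpha> i))"
        by (simp add: sum_distrib_left mult_ac)
    qed
    also have "\<dots> = (\<Sum>\<alpha>\<in>I. p \<alpha> * (\<Prod>i\<in>insert j S. (z $ i) ^ \<alpha> i))"
      unfolding J_def by (rule sum.group[OF insert.prems(1) finite_atMost N])
    also have "\<dots> = 0"
      by (rule insert.prems(3))
    finally show "(\<Sum>k\<le>N. (\<Sum>\<alpha>\<in>J k. p \<alpha> * (\<Prod>i\<in>S. (y $ i) ^ \<alpha> i)) * t ^ k) = 0" .
  qed
  have "\<alpha> j \<le> N"
    using N insert.prems(4) by auto
  show ?case
  proof (rule insert.IH)
    show "finite (J (\<alpha> j))" "\<alpha> \<in> J (\<alpha> j)"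
      using insert.prems by (auto simp: J_def)
    show "\<And>y. (\<Sum>\<alpha>\<in>J (\<alpha> j). p \<alpha> * (\<Prod>i\<in>S. (y $ i) ^ \<alpha> i)) = 0"
      using zero \<open>\<alpha> j \<le> N\<close> by blast
    \<comment> \<open>All members of \<open>J (\<alpha> j)\<close> have the same exponent at
      \<open>j\<close>, so they are still told apart by their exponents on \<open>S\<close>.\<close>
    show "\<beta> = \<gamma>" if "\<beta> \<in> J (\<alpha> j)" "\<gamma> \<in> J (\<alpha> j)" "\<forall>i\<in>S. \<beta> i = \<gamma> i" for \<beta> \<gamma>
      using that by (intro insert.prems(2)) (auto simp: J_def)
  qed
qed

lemma poly_eval_nonzero_ex:
  fixes q :: "('n::finite \<Rightarrow> nat) \<Rightarrow> real"
  assumes "finite I" "\<exists>\<alpha>\<in>I. q \<alpha> \<noteq> 0"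
  shows "\<exists>y. poly_eval I q y \<noteq> 0"
proof (rule ccontr)
  assume *: "\<nexists>y. poly_eval I q y \<noteq> 0"
  have "q \<alpha> = 0" if "\<alpha> \<in> I" for \<alpha>
    by (rule monomial_sum_eq_0_imp_coeff_eq_0[OF finite_class.finite_UNIV assms(1) _ _ that])
      (use * in \<open>auto simp: poly_eval_def\<close>)
  then show False using assms(2) by blast
qed

text \<open>\<open>rational_function\<close> uses one index set for numerator and denominator, so
  both are extended by zero to a common one. A polynomial with a nonzero value has a nonzero
  coefficient.\<close>

lemma gen_rational_imp_rational_function:
  assumes "gen_rational f"
  shows "rational_function f"
proof -
  obtain P Q where f: "real_polynomial_function P" "real_polynomial_function Q" "\<exists>y. Q y \<noteq> 0"
    "\<forall>y. Q y \<noteq> 0 \<longrightarrow> f y = P y / Q y"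
    using assms unfolding gen_rational_def by blast
  obtain I p where I: "finite I" "P = poly_eval I p"
    using real_polynomial_function_imp_poly_eval[OF f(1)] by blast
  obtain J q where J: "finite J" "Q = poly_eval J q"
    using real_polynomial_function_imp_poly_eval[OF f(2)] by blast
  define p' q' where "p' = (\<lambda>\<alpha>. if \<alpha> \<in> I then p \<alpha> else 0)" and "q' = (\<lambda>\<alpha>. if \<alpha> \<in> J then q \<alpha> else 0)"
  have PQ: "P = poly_eval (I \<union> J) p'" "Q = poly_eval (I \<union> J) q'"
    using I J poly_eval_superset[of "I \<union> J" I p] poly_eval_superset[of "I \<union> J" J q]
    by (auto simp: p'_def q'_def)
  have "\<exists>\<alpha>\<in>I \<union> J. q' \<alpha> \<noteq> 0"
    using f(3) unfolding PQ(2) poly_eval_def by (metis (no_types, lifting) mult_zero_left sum.neutral)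
  then show ?thesis
    unfolding rational_function_def
    by (intro exI[of _ "I \<union> J"] exI[of _ p'] exI[of _ q']) (use I J f(4) PQ in auto)
qed

section \<open>Total derivatives, and functions rational in y with coefficients depending on
  x\<close>

lemma has_derivative_imp_has_dir_deriv:
  assumes "(f has_derivative f') (at x)"
  shows "has_dir_deriv f x v (f' v)"
proof -
  interpret f': bounded_linear f'
    using assms by (rule has_derivative_bounded_linear)
  have "((\<lambda>t. x + t *\<^sub>R v) has_derivative (\<lambda>t. 0 + t *\<^sub>R v)) (at 0)"
    by (intro has_derivative_add has_derivative_const has_derivative_scaleR_left has_derivative_ident)
  then have "((\<lambda>t. f (x + t *\<^sub>R v)) has_derivative (\<lambda>t. f' (t *\<^sub>R v))) (at 0)"
    using has_derivative_compose[of "\<lambda>t. x + t *\<^sub>R v" "\<lambda>t. 0 + t *\<^sub>R v" 0 UNIV f f'] assms by simp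
  then show ?thesis
    by (simp add: has_field_derivative_def f'.scale mult_commute_abs)
qed

lemma smooth_on_imp_differentiable: "smooth_on S f \<Longrightarrow> x \<in> S \<Longrightarrow> f differentiable (at x)"
  unfolding smooth_on_def by (metis diff_times_on.simps(2))

text \<open>The restriction to \<open>y \<noteq> 0\<close> is a generic one, and the nonzero
  coefficient of the denominator provides a point where it does not vanish.\<close>

lemma rational_in_y_imp_gen_rational:
  assumes "rational_in_y V f" "x \<in> V"
  shows "gen_rational (f x)"
proof -
  obtain W I p q where W: "x \<in> W" "finite I" "\<forall>x\<in>W. (\<exists>\<alpha>\<in>I. q x \<alpha> \<noteq> 0) \<and>
      (\<forall>y. y \<noteq> 0 \<and> poly_eval I (q x) y \<noteq> 0 \<longrightarrow>
         f x y = poly_eval I (p x) y / poly_eval I (q x) y)"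
    using bspec[OF assms(1)[unfolded rational_in_y_def] assms(2)] by (elim exE conjE) (rule that)
  show ?thesis
  proof (rule gen_rationalI)
    show "\<exists>y. poly_eval I (q x) y \<noteq> 0"
      by (rule poly_eval_nonzero_ex[OF W(2) conjunct1[OF bspec[OF W(3,1)]]])
    show "generically (\<lambda>y. poly_eval I (q x) y \<noteq> 0 \<longrightarrow>
        f x y = poly_eval I (p x) y / poly_eval I (q x) y)"
      using generically_nonzero
      by (rule generically_mono) (use bspec[OF W(3,1), THEN conjunct2] in blast)
  qed (rule real_polynomial_function_poly_eval)+
qed

text \<open>For fixed \<open>y\<close>, numerator and denominator are differentiated coefficientwise
  in \<open>x\<close>, which leaves polynomials in \<open>y\<close>; the quotient rule then gives a
  rational function of \<open>y\<close>.\<close>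

lemma rational_in_y_dir_deriv:
  assumes "rational_in_y V f" "x \<in> V"
  shows "\<exists>g. gen_rational g \<and> generically (\<lambda>y. has_dir_deriv (\<lambda>x. f x y) x v (g y))"
proof -
  obtain W I p q where W: "open W" "x \<in> W" "finite I"
    and smooth: "\<forall>\<alpha>\<in>I. smooth_on W (\<lambda>x. p x \<alpha>) \<and> smooth_on W (\<lambda>x. q x \<alpha>)"
    and f: "\<forall>x\<in>W. (\<exists>\<alpha>\<in>I. q x \<alpha> \<noteq> 0) \<and>
      (\<forall>y. y \<noteq> 0 \<and> poly_eval I (q x) y \<noteq> 0 \<longrightarrow>
         f x y = poly_eval I (p x) y / poly_eval I (q x) y)"
    using bspec[OF assms(1)[unfolded rational_in_y_def] assms(2)] by (elim exE conjE) (rule that)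
  have diff: "(\<lambda>x. p x \<alpha>) differentiable (at x)" "(\<lambda>x. q x \<alpha>) differentiable (at x)" if "\<alpha> \<in> I" for \<alpha>
    using smooth that W(2) smooth_on_imp_differentiable by blast+
  \<comment> \<open>The new coefficients must not depend on \<open>y\<close>, hence the order of the
    quantifiers.\<close>
  have poly: "\<exists>r'. \<forall>y. has_dir_deriv (\<lambda>x. poly_eval I (r x) y) x v (poly_eval I r' y)"
    if r: "\<And>\<alpha>. \<alpha> \<in> I \<Longrightarrow> (\<lambda>x. r x \<alpha>) differentiable (at x)" for r
  proof -
    have "\<exists>D. has_dir_deriv (\<lambda>x. r x \<alpha>) x v D" if "\<alpha> \<in> I" for \<alpha>
      using r[OF that] has_derivative_imp_has_dir_deriv unfolding differentiable_def by blast
    then obtain r' where "\<And>\<alpha>. \<alpha> \<in> I \<Longrightarrow> has_dir_deriv (\<lambda>x. r x \<alpha>) x v (r' \<alpha>)"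
      by metis
    then have "has_dir_deriv (\<lambda>x. poly_eval I (r x) y) x v (poly_eval I r' y)" for y
      unfolding poly_eval_def by (intro DERIV_sum DERIV_cmult_right)
    then show ?thesis by blast
  qed
  obtain p' where p': "\<forall>y. has_dir_deriv (\<lambda>x. poly_eval I (p x) y) x v (poly_eval I p' y)"
    using poly[of p] diff by blast
  obtain q' where q': "\<forall>y. has_dir_deriv (\<lambda>x. poly_eval I (q x) y) x v (poly_eval I q' y)"
    using poly[of q] diff by blast
  let ?P = "poly_eval I (p x)" and ?Q = "poly_eval I (q x)"
  let ?g = "\<lambda>y. (poly_eval I p' y * ?Q y - ?P y * poly_eval I q' y) / (?Q y * ?Q y)"
  have "gen_rational ?g"
    by (intro gen_rational_intros gen_rational_polynomial real_polynomial_function_poly_eval)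
  moreover have "generically (\<lambda>y. ?Q y \<noteq> 0)"
    unfolding generically_def
    using poly_eval_nonzero_ex[OF W(3) conjunct1[OF bspec[OF f W(2)]]]
    by (intro exI[of _ ?Q] conjI real_polynomial_function_poly_eval) simp_all
  then have "generically (\<lambda>y. has_dir_deriv (\<lambda>x. f x y) x v (?g y))"
  proof (rule generically_mono[OF generically_conj[OF generically_nonzero]])
    fix y :: "real^'a" assume y: "y \<noteq> 0 \<and> ?Q y \<noteq> 0"
    \<comment> \<open>The quotient has to represent \<open>f\<close> at all base points near
      \<open>x\<close> with \<open>y\<close> fixed; continuity of the coefficients keeps the
      denominator nonzero there.\<close>
    have "isCont (\<lambda>x. q x \<alpha>) x" if "\<alpha> \<in> I" for \<alpha>
      using diff(2)[OF that] by (rule differentiable_imp_continuous_within)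
    then have "isCont (\<lambda>x. poly_eval I (q x) y) x"
      unfolding poly_eval_def by (intro continuous_intros)
    then have "((\<lambda>x. poly_eval I (q x) y) \<longlongrightarrow> ?Q y) (nhds x)"
      unfolding isCont_def using tendsto_at_iff_tendsto_nhds[of "\<lambda>x. poly_eval I (q x) y" x] by blast
    then have "eventually (\<lambda>x. poly_eval I (q x) y \<noteq> 0) (nhds x)"
      using y by (intro tendsto_imp_eventually_ne) auto
    moreover have "eventually (\<lambda>x. x \<in> W) (nhds x)"
      using W by (simp add: eventually_nhds_in_open)
    ultimately have "eventually (\<lambda>x. f x y = poly_eval I (p x) y / poly_eval I (q x) y) (nhds x)"
      by eventually_elim (use f y in blast)
    then show "has_dir_deriv (\<lambda>x. f x y) x v (?g y)"
      by (rule has_dir_deriv_cong[rotated])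
        (use p' q' y in \<open>auto intro!: has_dir_deriv_divide[of "\<lambda>x. poly_eval I (p x) y" _ _ _ "\<lambda>x. poly_eval I (q x) y"]\<close>)
  qed
  ultimately show ?thesis by (intro exI[of _ ?g]) simp
qed

lemma d_y_eqI: "has_dir_deriv (f x) y (axis r 1) D \<Longrightarrow> d_y r f x y = D"
  unfolding d_y_def by (rule DERIV_imp_deriv)

lemma d_x_eqI: "has_dir_deriv (\<lambda>x. f x y) x (axis k 1) D \<Longrightarrow> d_x k f x y = D"
  unfolding d_x_def by (rule DERIV_imp_deriv)

lemma has_dir_deriv_snd:
  assumes "((\<lambda>(x, y). f x y) has_derivative h) (at (x, y))"
  shows "has_dir_deriv (f x) y v (h (0, v))"
  using has_derivative_imp_has_dir_deriv[OF assms, of "(0, v)"] by simp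

lemma has_dir_deriv_fst:
  assumes "((\<lambda>(x, y). f x y) has_derivative h) (at (x, y))"
  shows "has_dir_deriv (\<lambda>x. f x y) x v (h (v, 0))"
  using has_derivative_imp_has_dir_deriv[OF assms, of "(v, 0)"] by simp

section \<open>Inverses of scaled and positive definite matrices; Euler's theorem\<close>

lemma invertible_matrix_inv:
  fixes B :: "real^'n^'n"
  assumes "invertible B"
  shows "B ** matrix_inv B = mat 1" "matrix_inv B ** B = mat 1"
  using someI_ex[OF assms[unfolded invertible_def]] unfolding matrix_inv_def by auto

text \<open>Inverses are unique, and the right-hand side is one. Applied to the metric tensor, this
  isolates the factor \<eta> that cancels in the spray coefficients.\<close>

lemma matrix_inv_scaleR:
  fixes B :: "real^'n^'n"
  assumes "invertible B" "c \<noteq> 0"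
  shows "matrix_inv (c *\<^sub>R B) = inverse c *\<^sub>R matrix_inv B"
proof -
  note B = invertible_matrix_inv[OF assms(1)]
  have "(c *\<^sub>R B) ** (inverse c *\<^sub>R matrix_inv B) = mat 1"
    "(inverse c *\<^sub>R matrix_inv B) ** (c *\<^sub>R B) = mat 1"
    using assms(2) B by (simp_all add: matrix_scalar_ac scalar_matrix_assoc[symmetric])
  then have inv: "invertible (c *\<^sub>R B)" and
    r: "(c *\<^sub>R B) ** (inverse c *\<^sub>R matrix_inv B) = mat 1"
    unfolding invertible_def by blast+
  have "matrix_inv (c *\<^sub>R B) = matrix_inv (c *\<^sub>R B) ** ((c *\<^sub>R B) ** (inverse c *\<^sub>R matrix_inv B))"
    by (simp only: r matrix_mul_rid)
  also have "\<dots> = inverse c *\<^sub>R matrix_inv B"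
    by (simp only: matrix_mul_assoc invertible_matrix_inv(2)[OF inv] matrix_mul_lid)
  finally show ?thesis .
qed

lemma pos_def_sym_imp_invertible:
  assumes "pos_def_sym B"
  shows "invertible B"
proof -
  have "v = 0" if "B *v v = 0" for v
    using assms that unfolding pos_def_sym_def by (metis inner_zero_right less_irrefl)
  then show ?thesis
    using matrix_left_invertible_ker[of B] invertible_left_inverse[of B] by blast
qed

text \<open>The derivative in the direction of \<open>y\<close> itself is computed twice: from
  homogeneity along the ray, and by linearity from the partial derivatives.\<close>

lemma euler_homogeneous:
  fixes h :: "real^'n::finite \<Rightarrow> real"
  assumes "h differentiable (at y)" and hom: "\<And>t. t > 0 \<Longrightarrow> h (t *\<^sub>R y) = t ^ k * h y"
    and "\<And>i. has_dir_deriv h y (axis i 1) (D i)"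
  shows "(\<Sum>i\<in>UNIV. y $ i * D i) = k * h y"
proof -
  obtain h' where h': "(h has_derivative h') (at y)"
    using assms(1) unfolding differentiable_def by blast
  interpret h': bounded_linear h'
    using h' by (rule has_derivative_bounded_linear)
  have D: "h' (axis i 1) = D i" for i
    using has_derivative_imp_has_dir_deriv[OF h'] assms(3) DERIV_unique by blast
  have "has_dir_deriv h y y (h' y)"
    using h' by (rule has_derivative_imp_has_dir_deriv)
  \<comment> \<open>Homogeneity is available for positive factors only, and the factor here is
    \<open>1 + t\<close>.\<close>
  moreover have "eventually (\<lambda>t::real. t > - 1) (nhds 0)"
    using eventually_nhds_in_open[of "{-1::real<..}" 0] by simp
  then have "eventually (\<lambda>t. h (y + t *\<^sub>R y) = (1 + t) ^ k * h y) (nhds 0)"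
    by eventually_elim (use hom[of "1 + t" for t] in \<open>simp add: scaleR_add_left\<close>)
  moreover have "((\<lambda>t. (1 + t) ^ k * h y) has_real_derivative k * h y) (at 0)"
    by (auto intro!: derivative_eq_intros)
  ultimately have "has_dir_deriv h y y (k * h y)" "has_dir_deriv h y y (h' y)"
    using DERIV_cong_ev[OF refl, of "\<lambda>t. h (y + t *\<^sub>R y)" "\<lambda>t. (1 + t) ^ k * h y" 0] by simp_all
  then have "h' y = k * h y"
    using DERIV_unique by blast
  moreover have "h' y = (\<Sum>i\<in>UNIV. y $ i * h' (axis i 1))"
  proof -
    have "h' y = h' (\<Sum>i\<in>UNIV. y $ i *\<^sub>R axis i 1)"
      by (simp add: basis_expansion scalar_mult_eq_scaleR[symmetric])
    then show ?thesis
      by (simp only: h'.sum h'.scale real_scaleR_def)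
  qed
  ultimately show ?thesis by (simp add: D)
qed

section \<open>The spray of an AR-Finsler metric in a chart\<close>

text \<open>The data in the coordinates of a single chart: \<open>V\<close> is its range, and
  \<open>f\<close>, \<open>e\<close>, \<open>a\<close> are the coordinate expressions of the Finsler
  metric, of \<eta> and of the matrix.\<close>

locale AR_Finsler_domain =
  fixes V :: "(real^'n::finite) set" and f e :: "real^'n \<Rightarrow> real^'n \<Rightarrow> real"
    and a :: "real^'n \<Rightarrow> real^'n \<Rightarrow> real^'n^'n"
  assumes open_V: "open V"
    and smooth_f: "smooth_on (V \<times> (- {0})) (\<lambda>(x, y). f x y)"
    and homogeneous_f: "\<And>x y t. x \<in> V \<Longrightarrow> t > 0 \<Longrightarrow> f x (t *\<^sub>R y) = t * f x y"
    and pos_metric: "\<And>x y. x \<in> V \<Longrightarrow> y \<noteq> 0 \<Longrightarrow> pos_def_sym (metric_tensor f x y)"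
    and metric: "\<And>x y. x \<in> V \<Longrightarrow> y \<noteq> 0 \<Longrightarrow> metric_tensor f x y = e x y *\<^sub>R a x y"
    and e_nonneg: "\<And>x y. x \<in> V \<Longrightarrow> y \<noteq> 0 \<Longrightarrow> e x y \<ge> 0"
    and smooth_e: "smooth_on (V \<times> (- {0})) (\<lambda>(x, y). e x y)"
    and pos_a: "\<And>x y. x \<in> V \<Longrightarrow> y \<noteq> 0 \<Longrightarrow> pos_def_sym (a x y)"
    and rational_a: "\<And>i j. rational_in_y V (\<lambda>x y. a x y $ i $ j)"
    and rational_ln_e: "\<And>k. rational_in_y V (d_x k (\<lambda>x y. ln (e x y)))"
begin

definition E :: "real^'n \<Rightarrow> real^'n \<Rightarrow> real" where
  "E = (\<lambda>x y. (f x y)\<^sup>2)"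

text \<open>The nesting of the sums follows the two applications of Euler's theorem that lead to
  \<open>E_eq\<close>.\<close>

definition b :: "real^'n \<Rightarrow> real^'n \<Rightarrow> real" where
  "b x y = (\<Sum>j\<in>UNIV. y $ j * (\<Sum>i\<in>UNIV. y $ i * a x y $ i $ j))"

text \<open>\<eta> is only assumed nonnegative, but where it vanished the metric tensor would be
  zero, against its positive definiteness. Division by \<eta> and its logarithm are therefore
  legitimate.\<close>

lemma e_pos:
  assumes "x \<in> V" "y \<noteq> 0"
  shows "e x y > 0"
proof -
  have "0 < y \<bullet> (metric_tensor f x y *v y)"
    using pos_metric[OF assms] assms(2) unfolding pos_def_sym_def by blast
  also have "\<dots> = e x y * (y \<bullet> (a x y *v y))"
    by (simp add: metric[OF assms] scaleR_matrix_vector_assoc[symmetric])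
  finally show ?thesis
    using e_nonneg[OF assms] by (metis less_eq_real_def mult_zero_left less_irrefl)
qed

lemma b_pos:
  assumes "x \<in> V" "y \<noteq> 0"
  shows "b x y > 0"
proof -
  have "b x y = y \<bullet> (a x y *v y)"
    unfolding b_def inner_vec_def matrix_vector_mult_def
    by (simp add: sum_distrib_left, subst sum.swap) (simp add: mult_ac)
  then show ?thesis
    using pos_a[OF assms] assms(2) unfolding pos_def_sym_def by simp
qed

text \<open>The total derivative of \<open>E\<close> on the product space, written as an explicit
  product so that it can be differentiated once more in the base point \<open>z\<close>.\<close>

definition DE :: "(real^'n) \<times> (real^'n) \<Rightarrow> (real^'n) \<times> (real^'n) \<Rightarrow> real" where
  "DE z h = 2 * (case z of (x, y) \<Rightarrow> f x y) * frechet_derivative (\<lambda>(x, y). f x y) (at z) h"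

lemma E_has_derivative:
  assumes "x \<in> V" "y \<noteq> 0"
  shows "((\<lambda>(x, y). E x y) has_derivative DE (x, y)) (at (x, y))"
proof -
  have "(\<lambda>(x, y). f x y) differentiable (at (x, y))"
    using smooth_on_imp_differentiable[OF smooth_f] assms by auto
  then have "((\<lambda>(x, y). f x y) has_derivative frechet_derivative (\<lambda>(x, y). f x y) (at (x, y))) (at (x, y))"
    by (simp add: frechet_derivative_works)
  from has_derivative_power[OF this, of 2] show ?thesis
    unfolding DE_def E_def by (simp add: case_prod_unfold mult_ac)
qed

lemma DE_differentiable:
  assumes "x \<in> V" "y \<noteq> 0"
  shows "(\<lambda>z. DE z h) differentiable (at (x, y))"
proof -
  have z: "(x, y) \<in> V \<times> - {0}" using assms by simp
  have "(\<lambda>(x, y). f x y) differentiable (at (x, y))"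
    using smooth_on_imp_differentiable[OF smooth_f z] .
  moreover have "diff_times_on (Suc (Suc 0)) (V \<times> - {0}) (\<lambda>(x, y). f x y)"
    using smooth_f unfolding smooth_on_def by blast
  then have "(\<lambda>z. frechet_derivative (\<lambda>(x, y). f x y) (at z) h) differentiable (at (x, y))"
    using z unfolding diff_times_on.simps by blast
  ultimately show ?thesis
    unfolding DE_def by (intro differentiable_mult differentiable_const)
qed

lemma d_y_E: "x \<in> V \<Longrightarrow> y \<noteq> 0 \<Longrightarrow> d_y r E x y = DE (x, y) (0, axis r 1)"
  by (rule d_y_eqI[OF has_dir_deriv_snd[OF E_has_derivative]])

lemma E_homogeneous: "x \<in> V \<Longrightarrow> t > 0 \<Longrightarrow> E x (t *\<^sub>R y) = t ^ 2 * E x y"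
  by (simp add: E_def homogeneous_f power_mult_distrib)

text \<open>Differentiate \<open>E x (t *\<^sub>R y + s *\<^sub>R axis r 1) = t\<^sup>2 * E x (y +
  (s / t) *\<^sub>R axis r 1)\<close> at \<open>s = 0\<close>. The exponent 1 is kept to fit
  \<open>euler_homogeneous\<close>.\<close>

lemma d_y_E_homogeneous:
  assumes x: "x \<in> V" and y: "y \<noteq> 0" and t: "t > 0"
  shows "d_y r E x (t *\<^sub>R y) = t ^ 1 * d_y r E x y"
proof -
  let ?D = "DE (x, y) (0, axis r 1)"
  have "has_dir_deriv (E x) y (axis r 1) ?D"
    using has_dir_deriv_snd[OF E_has_derivative[OF x y]] .
  then have "((\<lambda>s. E x (y + s *\<^sub>R axis r 1)) has_real_derivative ?D) (at (0 / t))"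
    by simp
  moreover have "((\<lambda>s. s / t) has_real_derivative 1 / t) (at 0)"
    by (intro DERIV_cdivide DERIV_ident)
  ultimately have "((\<lambda>s. t\<^sup>2 * E x (y + (s / t) *\<^sub>R axis r 1)) has_real_derivative
      t\<^sup>2 * (?D * (1 / t))) (at 0)"
    by (intro DERIV_cmult DERIV_chain2)
  moreover have "E x (t *\<^sub>R y + s *\<^sub>R axis r 1) = t\<^sup>2 * E x (y + (s / t) *\<^sub>R axis r 1)" for s
    using E_homogeneous[OF x t, of "y + (s / t) *\<^sub>R axis r 1"] t by (simp add: scaleR_add_right)
  ultimately have "has_dir_deriv (E x) (t *\<^sub>R y) (axis r 1) (t * ?D)"
    using t by (simp add: power2_eq_square)
  then show ?thesis
    using d_y_eqI d_y_E[OF x y] by simp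
qed

text \<open>Euler's theorem in degree one recovers the first derivatives of \<open>E\<close> from
  the second ones, and these are twice the entries of the metric tensor.\<close>

lemma d_y_E_eq:
  assumes x: "x \<in> V" and y: "y \<noteq> 0"
  shows "d_y r E x y = 2 * e x y * (\<Sum>i\<in>UNIV. y $ i * a x y $ i $ r)"
proof -
  \<comment> \<open>\<open>G\<close> coincides with \<open>d_y r E x\<close> away from the origin
    and is known to be totally differentiable, as Euler's theorem demands.\<close>
  define G where "G z = DE (x, z) (0, axis r 1)" for z
  have "((\<lambda>z. (x, z)) has_derivative (\<lambda>h. (0, h))) (at y)"
    by (intro has_derivative_Pair has_derivative_const has_derivative_ident)
  then have "(\<lambda>z. (x, z)) differentiable (at y)"
    unfolding differentiable_def by blast
  then have "(\<lambda>z. DE z (0, axis r 1)) \<circ> (\<lambda>z. (x, z)) differentiable (at y)"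
    by (intro differentiable_chain_at DE_differentiable x y)
  moreover have "(\<lambda>z. DE z (0, axis r 1)) \<circ> (\<lambda>z. (x, z)) = G"
    by (simp add: G_def fun_eq_iff)
  ultimately have "G differentiable (at y)" by simp
  moreover have "eventually (\<lambda>z. d_y r E x z = G z) (nhds y)"
    using t1_space_nhds[OF y] by (rule eventually_mono) (simp add: G_def d_y_E[OF x])
  moreover have G_dir: "has_dir_deriv G y (axis i 1) (d_y i (d_y r E) x y)" for i
  proof -
    obtain G' where "has_dir_deriv G y (axis i 1) G'"
      using \<open>G differentiable (at y)\<close> has_derivative_imp_has_dir_deriv unfolding differentiable_def by blast
    moreover from this have "has_dir_deriv (d_y r E x) y (axis i 1) G'"
      by (rule has_dir_deriv_cong) fact
    then have "d_y i (d_y r E) x y = G'"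
      by (rule d_y_eqI)
    ultimately show ?thesis by simp
  qed
  moreover have "G (t *\<^sub>R y) = t ^ 1 * G y" if "t > 0" for t
    using d_y_E_homogeneous[OF x y that, of r] d_y_E[OF x] y that by (simp add: G_def)
  ultimately have "(\<Sum>i\<in>UNIV. y $ i * d_y i (d_y r E) x y) = G y"
    using euler_homogeneous[of G y 1] by simp
  moreover have "d_y i (d_y r E) x y = 2 * (e x y * a x y $ i $ r)" for i
  proof -
    have "metric_tensor f x y $ i $ r = 1 / 2 * d_y i (d_y r E) x y"
      by (simp add: metric_tensor_def E_def)
    then show ?thesis by (simp add: metric[OF x y])
  qed
  ultimately show ?thesis
    by (simp add: d_y_E[OF x y] G_def[symmetric] sum_distrib_left mult_ac)
qed

text \<open>Euler's theorem once more, now in degree two, applied to \<open>E\<close> with the first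
  derivatives from \<open>d_y_E_eq\<close>.\<close>

lemma E_eq:
  assumes x: "x \<in> V" and y: "y \<noteq> 0"
  shows "E x y = e x y * b x y"
proof -
  have "((\<lambda>z. (x, z)) has_derivative (\<lambda>h. (0, h))) (at y)"
    by (intro has_derivative_Pair has_derivative_const has_derivative_ident)
  then have "(\<lambda>z. (x, z)) differentiable (at y)"
    unfolding differentiable_def by blast
  moreover have "(\<lambda>(x, y). E x y) differentiable (at (x, y))"
    using E_has_derivative[OF x y] unfolding differentiable_def by blast
  ultimately have "E x differentiable (at y)"
    using differentiable_chain_at[of "\<lambda>z. (x, z)" y "\<lambda>(x, y). E x y"] by (simp add: o_def)
  then have "(\<Sum>i\<in>UNIV. y $ i * d_y i E x y) = real 2 * E x y"
    using has_dir_deriv_snd[OF E_has_derivative[OF x y]] d_y_E[OF x y]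
    by (intro euler_homogeneous) (simp_all add: E_homogeneous[OF x])
  moreover have "(\<Sum>i\<in>UNIV. y $ i * d_y i E x y) = 2 * (e x y * b x y)"
    by (simp add: d_y_E_eq[OF x y] b_def sum_distrib_left mult_ac)
  ultimately show ?thesis by simp
qed

lemma e_dir_deriv:
  assumes "x \<in> V" "y \<noteq> 0"
  shows "\<exists>D. has_dir_deriv (\<lambda>x. e x y) x v D" "\<exists>D. has_dir_deriv (e x) y v D"
proof -
  have "(\<lambda>(x, y). e x y) differentiable (at (x, y))"
    using smooth_on_imp_differentiable[OF smooth_e] assms by auto
  then obtain h where h: "((\<lambda>(x, y). e x y) has_derivative h) (at (x, y))"
    unfolding differentiable_def by blast
  show "\<exists>D. has_dir_deriv (\<lambda>x. e x y) x v D" "\<exists>D. has_dir_deriv (e x) y v D"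
    using has_dir_deriv_fst[OF h] has_dir_deriv_snd[OF h] by blast+
qed

text \<open>By the product rule, the derivative of \<open>e * b\<close> is \<open>e\<close> times
  the sum of \<open>b\<close> times the logarithmic derivative of \<open>e\<close> and the
  derivative of \<open>b\<close>; both summands are rational in \<open>y\<close>.\<close>

lemma d_x_E_rational:
  assumes x: "x \<in> V"
  shows "\<exists>R. gen_rational R \<and> generically (\<lambda>y. d_x k E x y = e x y * R y)"
proof -
  have "\<forall>i j. \<exists>g. gen_rational g \<and>
      generically (\<lambda>y. has_dir_deriv (\<lambda>x. a x y $ i $ j) x (axis k 1) (g y))"
    by (intro allI rational_in_y_dir_deriv[OF rational_a x])
  then obtain g where "\<forall>i j. gen_rational (g i j) \<and>
      generically (\<lambda>y. has_dir_deriv (\<lambda>x. a x y $ i $ j) x (axis k 1) (g i j y))"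
    unfolding choice_iff by (elim exE) (rule that)
  then have g: "gen_rational (g i j)"
    "generically (\<lambda>y. has_dir_deriv (\<lambda>x. a x y $ i $ j) x (axis k 1) (g i j y))" for i j
    by simp_all
  define B where "B y = (\<Sum>j\<in>UNIV. y $ j * (\<Sum>i\<in>UNIV. y $ i * g i j y))" for y
  define L where "L = d_x k (\<lambda>x y. ln (e x y)) x"
  let ?R = "\<lambda>y. L y * b x y + B y"
  have a: "gen_rational (\<lambda>y. a x y $ i $ j)" for i j
    by (rule rational_in_y_imp_gen_rational[OF rational_a x])
  have "gen_rational L"
    unfolding L_def by (rule rational_in_y_imp_gen_rational[OF rational_ln_e x])
  then have "gen_rational ?R"
    unfolding b_def B_def by (intro gen_rational_intros a g(1))
  moreover have "generically (\<lambda>y. d_x k E x y = e x y * ?R y)"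
  proof (rule generically_mono)
    show "generically (\<lambda>y. y \<noteq> 0 \<and>
        (\<forall>i j. has_dir_deriv (\<lambda>x. a x y $ i $ j) x (axis k 1) (g i j y)))"
      by (intro generically_conj generically_nonzero generically_all_finite g(2))
  next
    fix y :: "real^'n"
    assume *: "y \<noteq> 0 \<and> (\<forall>i j. has_dir_deriv (\<lambda>x. a x y $ i $ j) x (axis k 1) (g i j y))"
    then have y: "y \<noteq> 0" by simp
    have b': "has_dir_deriv (\<lambda>x. b x y) x (axis k 1) (B y)"
      unfolding b_def B_def by (intro DERIV_sum DERIV_cmult) (use * in blast)
    obtain D where D: "has_dir_deriv (\<lambda>x. e x y) x (axis k 1) D"
      using e_dir_deriv(1)[OF x y] by blast
    have "has_dir_deriv (\<lambda>x. ln (e x y)) x (axis k 1) (inverse (e x y) * D)"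
      using DERIV_chain2[OF _ D, of ln "inverse (e x y)"] DERIV_ln[OF e_pos[OF x y]] by simp
    then have "L y = inverse (e x y) * D"
      unfolding L_def by (rule d_x_eqI)
    then have "D = e x y * L y"
      using e_pos[OF x y] by (simp add: field_simps)
    then have "has_dir_deriv (\<lambda>x. e x y * b x y) x (axis k 1) (e x y * ?R y)"
      using DERIV_mult[OF D b'] by (simp add: algebra_simps)
    \<comment> \<open>Openness of the chart range makes the factorization available at nearby base
      points, so it can be differentiated in \<open>x\<close>.\<close>
    moreover have "eventually (\<lambda>x. E x y = e x y * b x y) (nhds x)"
      using eventually_nhds_in_open[OF open_V x] by (rule eventually_mono) (rule E_eq[OF _ y])
    ultimately have "has_dir_deriv (\<lambda>x. E x y) x (axis k 1) (e x y * ?R y)"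
      by (rule has_dir_deriv_cong)
    then show "d_x k E x y = e x y * ?R y"
      by (rule d_x_eqI)
  qed
  ultimately show ?thesis by (intro exI[of _ ?R]) simp
qed

text \<open>Comparing \<open>\<partial>\<^sub>r (\<eta> a\<^sub>i\<^sub>j y\<^sup>i y\<^sup>j)\<close> (derivatives in \<open>y\<close>) with \<open>2 \<eta> a\<^sub>r\<^sub>j y\<^sup>j\<close> expresses
  the logarithmic derivative of \<open>\<eta>\<close> in \<open>y\<close> through the \<open>a\<^sub>i\<^sub>j\<close> and their derivatives.\<close>

lemma e_dir_deriv_rational:
  assumes x: "x \<in> V"
  shows "\<exists>L. gen_rational L \<and> generically (\<lambda>y. has_dir_deriv (e x) y (axis r 1) (e x y * L y))"
proof -
  have a: "gen_rational (\<lambda>y. a x y $ i $ j)" for i j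
    by (rule rational_in_y_imp_gen_rational[OF rational_a x])
  have b: "gen_rational (b x)"
    unfolding b_def by (intro gen_rational_intros a)
  obtain b' where b': "gen_rational b'" "generically (\<lambda>y. has_dir_deriv (b x) y (axis r 1) (b' y))"
    using gen_rational_dir_deriv[OF b] by blast
  let ?L = "\<lambda>y. (2 * (\<Sum>i\<in>UNIV. y $ i * a x y $ i $ r) - b' y) / b x y"
  have "gen_rational ?L"
    by (intro gen_rational_intros a b b')
  moreover have "generically (\<lambda>y. has_dir_deriv (e x) y (axis r 1) (e x y * ?L y))"
  proof (rule generically_mono[OF generically_conj[OF generically_nonzero b'(2)]])
    fix y :: "real^'n" assume *: "y \<noteq> 0 \<and> has_dir_deriv (b x) y (axis r 1) (b' y)"
    then have y: "y \<noteq> 0" by simp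
    obtain D where D: "has_dir_deriv (e x) y (axis r 1) D"
      using e_dir_deriv(2)[OF x y] by blast
    have "has_dir_deriv (\<lambda>y. e x y * b x y) y (axis r 1) (D * b x y + b' y * e x y)"
      using DERIV_mult[OF D conjunct2[OF *]] by simp
    moreover have "eventually (\<lambda>y. E x y = e x y * b x y) (nhds y)"
      using t1_space_nhds[OF y] by (rule eventually_mono) (rule E_eq[OF x])
    ultimately have "has_dir_deriv (E x) y (axis r 1) (D * b x y + b' y * e x y)"
      by (rule has_dir_deriv_cong)
    then have "2 * e x y * (\<Sum>i\<in>UNIV. y $ i * a x y $ i $ r) = D * b x y + b' y * e x y"
      using d_y_eqI d_y_E_eq[OF x y] by metis
    then have "D = e x y * ?L y"
      using b_pos[OF x y] by (simp add: field_simps)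
    then show "has_dir_deriv (e x) y (axis r 1) (e x y * ?L y)"
      using D by simp
  qed
  ultimately show ?thesis by (intro exI[of _ ?L]) simp
qed

text \<open>Both terms in the bracket of the spray coefficient are \<eta> times rational functions,
  and the inverse metric tensor is a rational matrix divided by \<eta>.\<close>

lemma spray_coeff_rational:
  assumes x: "x \<in> V"
  shows "gen_rational (spray_coeff f i x)"
proof -
  have "\<forall>k. \<exists>R. gen_rational R \<and> generically (\<lambda>y. d_x k E x y = e x y * R y)"
    by (intro allI d_x_E_rational[OF x])
  then obtain R where "\<forall>k. gen_rational (R k) \<and> generically (\<lambda>y. d_x k E x y = e x y * R k y)"
    unfolding choice_iff by (elim exE) (rule that)
  then have R: "gen_rational (R k)" "generically (\<lambda>y. d_x k E x y = e x y * R k y)" for k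
    by simp_all
  have "\<forall>r. \<exists>L. gen_rational L \<and>
      generically (\<lambda>y. has_dir_deriv (e x) y (axis r 1) (e x y * L y))"
    by (intro allI e_dir_deriv_rational[OF x])
  then obtain L where "\<forall>r. gen_rational (L r) \<and>
      generically (\<lambda>y. has_dir_deriv (e x) y (axis r 1) (e x y * L r y))"
    unfolding choice_iff by (elim exE) (rule that)
  then have L: "gen_rational (L r)"
    "generically (\<lambda>y. has_dir_deriv (e x) y (axis r 1) (e x y * L r y))" for r
    by simp_all
  have "\<forall>k r. \<exists>R'. gen_rational R' \<and> generically (\<lambda>y. has_dir_deriv (R k) y (axis r 1) (R' y))"
    by (intro allI gen_rational_dir_deriv R(1))
  then obtain R' where "\<forall>k r. gen_rational (R' k r) \<and>
      generically (\<lambda>y. has_dir_deriv (R k) y (axis r 1) (R' k r y))"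
    unfolding choice_iff by (elim exE) (rule that)
  then have R': "gen_rational (R' k r)"
    "generically (\<lambda>y. has_dir_deriv (R k) y (axis r 1) (R' k r y))" for k r
    by simp_all
  \<comment> \<open>The product rule for \<open>e * R k\<close> in direction \<open>r\<close>, with
    the factor \<open>e\<close> taken out.\<close>
  define T where "T k r y = L r y * R k y + R' k r y" for k r y
  let ?G = "\<lambda>y. (1 / 4) * (\<Sum>r\<in>UNIV. matrix_inv (a x y) $ i $ r * ((\<Sum>k\<in>UNIV. y $ k * T k r y) - R r y))"
  have "generically (\<lambda>y. det (a x y) \<noteq> 0)"
    using generically_nonzero
    by (rule generically_mono)
      (simp add: invertible_det_nz[symmetric] pos_def_sym_imp_invertible pos_a[OF x])
  then have "gen_rational (\<lambda>y. matrix_inv (a x y) $ i $ r)" for r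
    by (intro gen_rational_matrix_inv rational_in_y_imp_gen_rational[OF rational_a x])
  then have "gen_rational ?G"
    unfolding T_def by (intro gen_rational_intros R L R')
  moreover have "generically (\<lambda>y. spray_coeff f i x y = ?G y)"
  proof (rule generically_mono)
    \<comment> \<open>The formula for \<open>d_x k E\<close> is wanted also near \<open>y\<close>,
      since it is differentiated in \<open>y\<close>.\<close>
    show "generically (\<lambda>y. y \<noteq> 0 \<and> (\<forall>k. d_x k E x y = e x y * R k y) \<and>
        (\<forall>k. eventually (\<lambda>y. d_x k E x y = e x y * R k y) (nhds y)) \<and>
        (\<forall>r. has_dir_deriv (e x) y (axis r 1) (e x y * L r y)) \<and>
        (\<forall>k r. has_dir_deriv (R k) y (axis r 1) (R' k r y)))"
      by (intro generically_conj generically_nonzero generically_all_finite generically_nhds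
          R(2) L(2) R'(2))
  next
    fix y :: "real^'n"
    assume *: "y \<noteq> 0 \<and> (\<forall>k. d_x k E x y = e x y * R k y) \<and>
        (\<forall>k. eventually (\<lambda>y. d_x k E x y = e x y * R k y) (nhds y)) \<and>
        (\<forall>r. has_dir_deriv (e x) y (axis r 1) (e x y * L r y)) \<and>
        (\<forall>k r. has_dir_deriv (R k) y (axis r 1) (R' k r y))"
    then have y: "y \<noteq> 0" by simp
    have d_y_d_x: "d_y r (d_x k E) x y = e x y * T k r y" for k r
    proof (rule d_y_eqI)
      have "has_dir_deriv (\<lambda>y. e x y * R k y) y (axis r 1) (e x y * L r y * R k y + R' k r y * e x y)"
        using DERIV_mult[of "\<lambda>t. e x (y + t *\<^sub>R axis r 1)" "e x y * L r y" 0 UNIV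
            "\<lambda>t. R k (y + t *\<^sub>R axis r 1)" "R' k r y"] * by simp
      then have "has_dir_deriv (\<lambda>y. e x y * R k y) y (axis r 1) (e x y * T k r y)"
        by (simp add: T_def algebra_simps)
      then show "has_dir_deriv (d_x k E x) y (axis r 1) (e x y * T k r y)"
        by (rule has_dir_deriv_cong) (use * in blast)
    qed
    have inv: "matrix_inv (metric_tensor f x y) = inverse (e x y) *\<^sub>R matrix_inv (a x y)"
      unfolding metric[OF x y]
      using e_pos[OF x y] pos_def_sym_imp_invertible[OF pos_a[OF x y]]
      by (intro matrix_inv_scaleR) auto
    have "spray_coeff f i x y = (1 / 4) * (\<Sum>r\<in>UNIV. matrix_inv (metric_tensor f x y) $ i $ r *
        ((\<Sum>k\<in>UNIV. y $ k * d_y r (d_x k E) x y) - d_x r E x y))"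
      unfolding spray_coeff_def E_def ..
    also have "\<dots> = (1 / 4) * (\<Sum>r\<in>UNIV. inverse (e x y) * matrix_inv (a x y) $ i $ r *
        (e x y * ((\<Sum>k\<in>UNIV. y $ k * T k r y) - R r y)))"
      unfolding inv d_y_d_x using * by (simp add: sum_distrib_left right_diff_distrib mult_ac)
    also have "\<dots> = ?G y"
      using e_pos[OF x y] by (intro arg_cong[of _ _ "(*) (1 / 4)"] sum.cong refl) simp
    finally show "spray_coeff f i x y = ?G y" .
  qed
  ultimately show ?thesis by (rule gen_rational_cong)
qed

lemma Barthel_connection_rational:
  assumes "x \<in> V"
  shows "gen_rational (Barthel_connection f i j x)"
proof -
  obtain g where g: "gen_rational g"
    "generically (\<lambda>y. has_dir_deriv (spray_coeff f i x) y (axis j 1) (g y))"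
    using gen_rational_dir_deriv[OF spray_coeff_rational[OF assms]] by blast
  from g(1) show ?thesis
    by (rule gen_rational_cong)
      (rule generically_mono[OF g(2)], simp add: Barthel_connection_def d_y_eqI)
qed

end

section \<open>Isotropic S-curvature and irrationality of the metric\<close>

theorem theorem3p17:
  fixes \<A> :: "('m::{t2_space, second_countable_topology}, 'n::finite) chart set"
    and F \<eta> :: "('m, 'n) tvec \<Rightarrow> real"
    and a :: "('m, 'n) chart \<Rightarrow> real^'n \<Rightarrow> real^'n \<Rightarrow> real^'n^'n"
    and \<sigma> :: "('m, 'n) chart \<Rightarrow> real^'n \<Rightarrow> real"
  assumes "smooth_atlas \<A>"
    and "AR_Finsler_metric \<A> F \<eta> a"
    and "volume_form \<A> \<sigma>"
    and "\<forall>c\<in>\<A>. \<forall>x\<in>chart_range c. \<not> rational_function (in_coords \<A> F c x)"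
    and "\<forall>c\<in>\<A>. \<forall>i. rational_in_y (chart_range c) (d_x i (\<lambda>x y. ln (in_coords \<A> \<eta> c x y)))"
    and "isotropic_S_curvature \<A> F \<sigma>"
  shows "\<forall>c\<in>\<A>. \<forall>x\<in>chart_range c. \<forall>y. y \<noteq> 0 \<longrightarrow> S_curvature \<A> F \<sigma> c x y = 0"
proof (intro ballI)
  fix c x assume c: "c \<in> \<A>" and x: "x \<in> chart_range c"
  note AR = assms(2)[unfolded AR_Finsler_metric_def Finsler_metric_def]
  note Finsler_c = bspec[OF conjunct1[OF AR] c] and AR_c = bspec[OF conjunct2[OF AR] c]
  interpret AR_Finsler_domain "chart_range c" "in_coords \<A> F c" "in_coords \<A> \<eta> c" "a c"
  proof (rule AR_Finsler_domain.intro)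
    show "open (chart_range c)"
      using assms(1) c unfolding smooth_atlas_def by blast
    show "smooth_on (chart_range c \<times> - {0}) (\<lambda>(x, y). in_coords \<A> F c x y)"
      using Finsler_c by (elim conjE)
    show "smooth_on (chart_range c \<times> - {0}) (\<lambda>(x, y). in_coords \<A> \<eta> c x y)"
      using AR_c by (elim conjE)
    show "rational_in_y (chart_range c) (\<lambda>x y. a c x y $ i $ j)" for i j
      by (rule spec[OF spec[OF conjunct1[OF conjunct2[OF conjunct2[OF conjunct2[OF conjunct2[OF AR_c]]]]]]])
    show "rational_in_y (chart_range c) (d_x i (\<lambda>x y. ln (in_coords \<A> \<eta> c x y)))" for i
      using bspec[OF assms(5) c] by (rule spec)
    show "in_coords \<A> F c x (t *\<^sub>R y) = t * in_coords \<A> F c x y"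
      if "x \<in> chart_range c" "t > 0" for x y t
      using conjunct1[OF conjunct2[OF conjunct2[OF Finsler_c]]] that by blast
    show "pos_def_sym (metric_tensor (in_coords \<A> F c) x y)"
      if "x \<in> chart_range c" "y \<noteq> 0" for x y
      using conjunct2[OF conjunct2[OF conjunct2[OF Finsler_c]]] that by blast
    show "metric_tensor (in_coords \<A> F c) x y = in_coords \<A> \<eta> c x y *\<^sub>R a c x y"
      if "x \<in> chart_range c" "y \<noteq> 0" for x y
      using conjunct1[OF AR_c] that by blast
    show "in_coords \<A> \<eta> c x y \<ge> 0" if "x \<in> chart_range c" "y \<noteq> 0" for x y
      using conjunct1[OF conjunct2[OF AR_c]] that by blast
    show "pos_def_sym (a c x y)" if "x \<in> chart_range c" "y \<noteq> 0" for x y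
      using conjunct1[OF conjunct2[OF conjunct2[OF conjunct2[OF AR_c]]]] that by blast
  qed
  obtain A where A: "\<forall>c\<in>\<A>. \<forall>x\<in>chart_range c. \<forall>y. y \<noteq> 0 \<longrightarrow>
      S_curvature \<A> F \<sigma> c x y = (real CARD('n) + 1) * A (chart_inv c x) * in_coords \<A> F c x y"
    using assms(6) unfolding isotropic_S_curvature_def by blast
  let ?A = "(real CARD('n) + 1) * A (chart_inv c x)"
  \<comment> \<open>For fixed \<open>x\<close> this factor is a constant; were it nonzero, dividing
    the S-curvature by it would exhibit the metric as rational at \<open>x\<close>.\<close>
  have "?A = 0"
  proof (rule ccontr)
    assume nz: "?A \<noteq> 0"
    have "gen_rational (S_curvature \<A> F \<sigma> c x)"
      \<comment> \<open>Unfolding \<open>d_x\<close> reveals that the derivative of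
        \<open>ln (\<sigma> c x)\<close> does not involve \<open>y\<close>, so the volume term is
        linear in \<open>y\<close>.\<close>
      unfolding S_curvature_def d_x_def
      by (intro gen_rational_intros Barthel_connection_rational x)
    then have "gen_rational (\<lambda>y. S_curvature \<A> F \<sigma> c x y / ?A)"
      by (intro gen_rational_divide gen_rational_const)
    then have "gen_rational (in_coords \<A> F c x)"
      by (rule gen_rational_cong, intro generically_mono[OF generically_nonzero])
        (use A c x nz in auto)
    then show False
      using gen_rational_imp_rational_function assms(4) c x by blast
  qed
  then show "\<forall>y. y \<noteq> 0 \<longrightarrow> S_curvature \<A> F \<sigma> c x y = 0"
    using A c x by auto
qed

end
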